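(* Let $\mathcal S$ be an S-quad graph with associated graphs $\mathcal G$ and $\mathcal G^*$. Pairs $(k^s,k^c)$ of regular, dual two-sphere Koebe nets (with underlying graphs $\mathcal G,\mathcal G^*$) touching the spheres $S^2_+$ and $S^2_-$ with radii $r_+$ and $r_-$ are in one-to-one correspondence with orthogonal ring patterns in $S^2$ (with underlying S-quad graph $\mathcal S$) with global parameter $q=\frac{r_-}{r_+}$. Under this correspondence the vertices of the Koebe nets correspond to the centers of the spherical rings (the center being $p_v=k_v/\|k_v\|$), and the points of tangency of the Koebe nets correspond to the touching points of the rings (by radial projection to $S^2$).
   Context: S-quad graph: a quad graph $\mathcal S$ with interior vertices of even degree such that (i) its vertices are bicolored black and white, $V=V_w\,\dot\cup\,V_b$, properly (each quad has two black and two white vertices); (ii) the white vertices are labeled s or c, $V_w=V_s\,\dot\cup\,V_c$, so that each quad has one white s-vertex and one white c-vertex; (iii) interior black vertices and interior c-vertices have degree $4$. $\mathcal G$ is the quad graph with vertex set $V_s$ whose edges correspond to black vertices and whose faces correspond to c-vertices; $\mathcal G^*$ is its dual graph with vertex set $V_c$. Edges of $\mathcal G$ are colored horizontal/vertical, alternating around each face; this extends to the edges of $\mathcal S$ so that colors alternate around each quad of $\mathcal S$ (the edge $(v,b)$, $v\in V_s$, has the color of the $\mathcal G$-edge through $b$; the edge $(v,b)$, $v\in V_c$, has the opposite color). Two-sphere Koebe net: a map $k$ from the vertices of $\mathcal G$ (or $\mathcal G^*$) to $\mathbb{R}^3$ with planar faces whose edges alternately touch two spheres $S_+^2,S_-^2$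 concentric with the unit sphere $S^2$ (centered at $0$), with radii $r_+>r_->0$, $r_+r_-=1$; horizontal edges touch $S_+^2$, vertical edges touch $S_-^2$. Dual pair: two-sphere Koebe nets $k^s:V(\mathcal G)\to\mathbb{R}^3$, $k^c:V(\mathcal G^* )\to\mathbb{R}^3$ such that (1) they touch the same spheres $S^2_\pm$; (2) vertex vectors of $k^s$ are normals of the corresponding faces of $k^c$ and vice versa; (3) dual edges of $k^s$ and $k^c$ are orthogonal, and their points of tangency lie on different spheres and project radially to the same point of $S^2$. For $v\in V_w$ write $k_v$ for the corresponding vertex. The pair is regular if at every vertex of $k^s$ and $k^c$ the adjacent points of tangency are cyclically ordered (clockwise or counterclockwise) according to the combinatorics. Spherical ring: a triple $(p,r,R)$ with $p\in S^2$, inner spherical radius $r$ (signed; $r>0$ means counterclockwise, $r<0$ clockwise orientation) and outer spherical radius $R>0$, with $|r|,R\le\frac\pi2$; it consists of the two concentric circles with center $p$ and spherical radii $|r|$ and $R$. Orthogonal ring pattern on $\mathcal S$: rings $(p_v,r_v,R_v)$, $v\in V_w$, such that (1) the rings of the s- and the c-vertex of each quad intersect orthogonally: the larger circle of each intersects the smaller circle of the other orthogonally; (2) for each black vertex $b$, the inner circles of the rings at the white neighbors joined to $b$ by horizontal edges and the outer circles of the rings at the white neighbors joined to $b$ by vertical edges all pass through one point $q_b$ (touching point); (3) for each ring the touching points at its neighboring black vertices, taken in the cyclic order given by the combinatorics, are ordered counterclockwise if $r_v>0$ and clockwise if $r_v<0$. For such a pattern there is a global constant $q<1$, the global parameter,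 with $q\cos r_v=\cos R_v$ for all $v$.
   Formalization: Rings are required to satisfy 0<|r|<R (r=0 and |r|=R=π/2, a vertex at infinity, are excluded); at a vertex with only two touching points the orientation is that of the face angle, taken less than π; tangency and touching points are part of the data. *)

theory Defs
  imports "HOL-Analysis.Analysis"
begin

section \<open>Quad graphs\<close>

text \<open>
  A quad graph is a cell decomposition of a connected oriented surface, possibly with boundary and
  possibly infinite, into quadrilaterals. It is given by its set \<open>F\<close> of faces: \<open>(a, b, c, d) \<in> F\<close>
  means that \<open>a, b, c, d\<close> are the vertices of a face in counterclockwise order, so every face
  occurs in \<open>F\<close> with its four rotations. Edges are determined by their end points.
\<close>

type_synonym 'v faces = "('v \<times> 'v \<times> 'v \<times> 'v) set"

definition verts :: "'v faces \<Rightarrow> 'v set" where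
  "verts F = {a. \<exists>b c d. (a, b, c, d) \<in> F}"

definition adj :: "'v faces \<Rightarrow> 'v \<Rightarrow> 'v \<Rightarrow> bool" where
  "adj F x y \<longleftrightarrow> (\<exists>c d. (x, y, c, d) \<in> F \<or> (y, x, c, d) \<in> F)"

definition opposite :: "'v faces \<Rightarrow> 'v \<Rightarrow> 'v \<Rightarrow> bool" where
  "opposite F v w \<longleftrightarrow> (\<exists>x y. (v, x, w, y) \<in> F)"

definition degree :: "'v faces \<Rightarrow> 'v \<Rightarrow> nat" where
  "degree F v = card {w. adj F v w}"

text \<open>
  \<open>(x, y) \<in> corners F v\<close>: turning counterclockwise around \<open>v\<close>, the edge \<open>v y\<close> is the next one
  after \<open>v x\<close>, the two edges being separated by one face.
\<close>

definition corners :: "'v faces \<Rightarrow> 'v \<Rightarrow> ('v \<times> 'v) set" where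
  "corners F v = {(x, y). \<exists>w. (v, x, w, y) \<in> F}"

definition consecutive :: "'a list \<Rightarrow> ('a \<times> 'a) set" where
  "consecutive xs = {(xs ! i, xs ! Suc i) | i. Suc i < length xs}"

text \<open>
  The list \<open>xs\<close> enumerates the neighbours of \<open>v\<close> counterclockwise; the faces at \<open>v\<close> close up
  around an interior vertex and form a fan at a boundary vertex.
\<close>

definition closed_star :: "'v faces \<Rightarrow> 'v \<Rightarrow> 'v list \<Rightarrow> bool" where
  "closed_star F v xs \<longleftrightarrow> distinct xs \<and> 3 \<le> length xs \<and>
     corners F v = insert (last xs, hd xs) (consecutive xs)"

definition open_star :: "'v faces \<Rightarrow> 'v \<Rightarrow> 'v list \<Rightarrow> bool" where
  "open_star F v xs \<longleftrightarrow> distinct xs \<and> 2 \<le> length xs \<and> corners F v = consecutive xs"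

definition star :: "'v faces \<Rightarrow> 'v \<Rightarrow> 'v list \<Rightarrow> bool" where
  "star F v xs \<longleftrightarrow> closed_star F v xs \<or> open_star F v xs"

definition interior_vertex :: "'v faces \<Rightarrow> 'v \<Rightarrow> bool" where
  "interior_vertex F v \<longleftrightarrow> (\<exists>xs. closed_star F v xs)"

definition quad_graph :: "'v faces \<Rightarrow> bool" where
  "quad_graph F \<longleftrightarrow>
     (\<forall>a b c d. (a, b, c, d) \<in> F \<longrightarrow> (b, c, d, a) \<in> F \<and> distinct [a, b, c, d]) \<and>
     (\<forall>a b c d c' d'. (a, b, c, d) \<in> F \<longrightarrow> (a, b, c', d') \<in> F \<longrightarrow> c = c' \<and> d = d') \<and>
     (\<forall>v \<in> verts F. \<exists>xs. star F v xs) \<and>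
     (\<forall>u \<in> verts F. \<forall>v \<in> verts F. (adj F)\<^sup>*\<^sup>* u v)"


section \<open>S-quad graphs\<close>

text \<open>
  The graph \<open>\<G>\<close> has the s-vertices as vertices, the black vertices as edges and the c-vertices as
  faces; in the dual graph the roles of s and c are exchanged. The end points of the edge \<open>b\<close> are
  the s-vertices (c-vertices) adjacent to \<open>b\<close>, so at the boundary an edge may have a single end
  point. The vertices of the face belonging to a white vertex \<open>f\<close> are those opposite to \<open>f\<close> in a
  quad, its edges are the black neighbours of \<open>f\<close>. The set \<open>horizontal\<close> consists of the black
  vertices whose \<open>\<G>\<close>-edge is horizontal.
\<close>

record 'v sgraph =
  faces :: "'v faces"
  black :: "'v set"
  sverts :: "'v set"
  cverts :: "'v set"
  horizontal :: "'v set"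

definition s_quad_graph :: "'v sgraph \<Rightarrow> bool" where
  "s_quad_graph S \<longleftrightarrow>
     quad_graph (faces S) \<and>
     (\<forall>v. interior_vertex (faces S) v \<longrightarrow> even (degree (faces S) v)) \<and>
     verts (faces S) = black S \<union> (sverts S \<union> cverts S) \<and>
     black S \<inter> (sverts S \<union> cverts S) = {} \<and> sverts S \<inter> cverts S = {} \<and>
     (\<forall>x y. adj (faces S) x y \<longrightarrow> (x \<in> black S \<longleftrightarrow> y \<notin> black S)) \<and>
     (\<forall>a b c d. (a, b, c, d) \<in> faces S \<longrightarrow> a \<notin> black S \<longrightarrow> (a \<in> sverts S \<longleftrightarrow> c \<in> cverts S)) \<and>
     (\<forall>v \<in> black S \<union> cverts S. interior_vertex (faces S) v \<longrightarrow> degree (faces S) v = 4)"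

text \<open>Consecutive edges of the \<open>\<G>\<close>-face of a c-vertex \<open>c\<close> are \<open>b, d\<close> for a quad \<open>a b c d\<close>.\<close>

definition alternating_colouring :: "'v sgraph \<Rightarrow> bool" where
  "alternating_colouring S \<longleftrightarrow>
     horizontal S \<subseteq> black S \<and>
     (\<forall>a b c d. (a, b, c, d) \<in> faces S \<longrightarrow> c \<in> cverts S \<longrightarrow>
        (b \<in> horizontal S \<longleftrightarrow> d \<notin> horizontal S))"

definition horizontal_edge :: "'v sgraph \<Rightarrow> 'v \<Rightarrow> 'v \<Rightarrow> bool" where
  "horizontal_edge S v b \<longleftrightarrow> (if v \<in> sverts S then b \<in> horizontal S else b \<notin> horizontal S)"


section \<open>Cyclic order around an axis\<close>

text \<open>
  The points \<open>xs\<close> are ordered counterclockwise around the axis \<open>a\<close>, seen from the tip of \<open>a\<close>: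
  their polar angles, in a positively oriented orthonormal frame \<open>e1, e2, sgn a\<close>, can be chosen
  increasing within one full turn. Two points are always cyclically ordered in this sense; two
  points arise only at a boundary vertex with a single face, and there the angle of that face
  decides: it has to be smaller than \<open>pi\<close>.
\<close>

definition ccw_around :: "real^3 \<Rightarrow> (real^3) list \<Rightarrow> bool" where
  "ccw_around a xs \<longleftrightarrow>
     (\<exists>e1 e2 h \<rho> \<theta>.
        norm e1 = 1 \<and> norm e2 = 1 \<and> e1 \<bullet> e2 = 0 \<and> cross3 e1 e2 = sgn a \<and>
        (\<forall>i < length xs. 0 < \<rho> i \<and>
           xs ! i = h i *\<^sub>R sgn a + \<rho> i *\<^sub>R (cos (\<theta> i) *\<^sub>R e1 + sin (\<theta> i) *\<^sub>R e2)) \<and>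
        (\<forall>i j. i < j \<longrightarrow> j < length xs \<longrightarrow> \<theta> i < \<theta> j \<and> \<theta> j < \<theta> i + 2 * pi) \<and>
        (length xs = 2 \<longrightarrow> \<theta> (1::nat) < \<theta> 0 + pi))"

definition cw_around :: "real^3 \<Rightarrow> (real^3) list \<Rightarrow> bool" where
  "cw_around a xs \<longleftrightarrow> ccw_around a (rev xs)"

definition ccw_at :: "'v faces \<Rightarrow> 'v \<Rightarrow> real^3 \<Rightarrow> ('v \<Rightarrow> real^3) \<Rightarrow> bool" where
  "ccw_at F v a x \<longleftrightarrow> (\<forall>bs. star F v bs \<longrightarrow> ccw_around a (map x bs))"

definition cw_at :: "'v faces \<Rightarrow> 'v \<Rightarrow> real^3 \<Rightarrow> ('v \<Rightarrow> real^3) \<Rightarrow> bool" where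
  "cw_at F v a x \<longleftrightarrow> (\<forall>bs. star F v bs \<longrightarrow> cw_around a (map x bs))"


section \<open>Two-sphere Koebe nets\<close>

text \<open>
  A net consists of its vertices and of the points of tangency of its edges, the latter indexed by
  the black vertices. The points of tangency are determined by the vertices if both end points of
  the edge are present and distinct; they are data for the sake of boundary edges with a single
  end point, and of edges whose end points coincide (these arise from adjacent rings with the same
  circles and opposite orientations). An edge touches a sphere if the line carrying it is tangent.

  Below, \<open>W\<close> is the vertex set, \<open>W'\<close> the set of faces and \<open>H\<close> the set of horizontal edges.
  Functions are \<open>extensional\<close>, so that equality of nets does not depend on irrelevant values.
\<close>

record 'v net =
  vertex :: "'v \<Rightarrow> real^3"
  tangency :: "'v \<Rightarrow> real^3"

definition edge_direction :: "'v sgraph \<Rightarrow> 'v set \<Rightarrow> 'v net \<Rightarrow> 'v \<Rightarrow> real^3 \<Rightarrow> bool" where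
  "edge_direction S W N b u \<longleftrightarrow> u \<noteq> 0 \<and>
     (\<forall>v \<in> W. adj (faces S) v b \<longrightarrow> (\<exists>x. vertex N v = tangency N b + x *\<^sub>R u))"

definition edge_touches :: "'v sgraph \<Rightarrow> 'v set \<Rightarrow> 'v net \<Rightarrow> 'v \<Rightarrow> real \<Rightarrow> bool" where
  "edge_touches S W N b r \<longleftrightarrow> norm (tangency N b) = r \<and>
     (\<exists>u. edge_direction S W N b u \<and> u \<bullet> tangency N b = 0)"

definition face_points :: "'v sgraph \<Rightarrow> 'v set \<Rightarrow> 'v net \<Rightarrow> 'v \<Rightarrow> (real^3) set" where
  "face_points S W N f =
     vertex N ` {v \<in> W. opposite (faces S) v f} \<union> tangency N ` {b. adj (faces S) f b}"

definition normal_of :: "real^3 \<Rightarrow> (real^3) set \<Rightarrow> bool" where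
  "normal_of n A \<longleftrightarrow> n \<noteq> 0 \<and> (\<exists>c. A \<subseteq> {x. n \<bullet> x = c})"

definition koebe_net ::
    "'v sgraph \<Rightarrow> 'v set \<Rightarrow> 'v set \<Rightarrow> 'v set \<Rightarrow> real \<Rightarrow> real \<Rightarrow> 'v net \<Rightarrow> bool" where
  "koebe_net S W W' H rp rm N \<longleftrightarrow>
     vertex N \<in> extensional W \<and> tangency N \<in> extensional (black S) \<and>
     (\<forall>f \<in> W'. \<exists>n. normal_of n (face_points S W N f)) \<and>
     (\<forall>b \<in> black S. edge_touches S W N b (if b \<in> H then rp else rm))"

definition dual_koebe_pair :: "'v sgraph \<Rightarrow> real \<Rightarrow> real \<Rightarrow> 'v net \<times> 'v net \<Rightarrow> bool" where
  "dual_koebe_pair S rp rm = (\<lambda>(Ns, Nc).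
     koebe_net S (sverts S) (cverts S) (horizontal S) rp rm Ns \<and>
     koebe_net S (cverts S) (sverts S) (black S - horizontal S) rp rm Nc \<and>
     (\<forall>v \<in> sverts S. normal_of (vertex Ns v) (face_points S (cverts S) Nc v)) \<and>
     (\<forall>v \<in> cverts S. normal_of (vertex Nc v) (face_points S (sverts S) Ns v)) \<and>
     (\<forall>b \<in> black S.
        (\<exists>u u'. edge_direction S (sverts S) Ns b u \<and> edge_direction S (cverts S) Nc b u' \<and>
           u \<bullet> u' = 0) \<and>
        norm (tangency Ns b) \<noteq> norm (tangency Nc b) \<and>
        sgn (tangency Ns b) = sgn (tangency Nc b)))"

definition regular_at :: "'v sgraph \<Rightarrow> 'v net \<Rightarrow> 'v \<Rightarrow> bool" where
  "regular_at S N v \<longleftrightarrow>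
     ccw_at (faces S) v (vertex N v) (tangency N) \<or> cw_at (faces S) v (vertex N v) (tangency N)"

definition regular_pair :: "'v sgraph \<Rightarrow> 'v net \<times> 'v net \<Rightarrow> bool" where
  "regular_pair S = (\<lambda>(Ns, Nc).
     (\<forall>v \<in> sverts S. regular_at S Ns v) \<and> (\<forall>v \<in> cverts S. regular_at S Nc v))"


section \<open>Orthogonal ring patterns in the sphere\<close>

text \<open>
  A ring is nondegenerate: its two circles are distinct, and the inner one is not a point, so that
  its orientation, the sign of \<open>inner\<close>, makes sense.
\<close>

record ring =
  center :: "real^3"
  inner :: real
  outer :: real

definition spherical_ring :: "ring \<Rightarrow> bool" where
  "spherical_ring A \<longleftrightarrow>
     center A \<in> sphere 0 1 \<and> inner A \<noteq> 0 \<and> \<bar>inner A\<bar> < outer A \<and> outer A \<le> pi / 2"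

definition circle :: "real^3 \<Rightarrow> real \<Rightarrow> (real^3) set" where
  "circle p r = {x \<in> sphere 0 1. arccos (p \<bullet> x) = r}"

text \<open>The vector \<open>cross3 p x\<close> is tangent at \<open>x\<close> to the circle with center \<open>p\<close> through \<open>x\<close>.\<close>

definition orthogonal_circles :: "real^3 \<Rightarrow> real \<Rightarrow> real^3 \<Rightarrow> real \<Rightarrow> bool" where
  "orthogonal_circles p r p' r' \<longleftrightarrow>
     circle p r \<inter> circle p' r' \<noteq> {} \<and>
     (\<forall>x \<in> circle p r \<inter> circle p' r'. cross3 p x \<bullet> cross3 p' x = 0)"

definition orthogonal_rings :: "ring \<Rightarrow> ring \<Rightarrow> bool" where
  "orthogonal_rings A B \<longleftrightarrow>
     orthogonal_circles (center A) (outer A) (center B) \<bar>inner B\<bar> \<and>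
     orthogonal_circles (center A) \<bar>inner A\<bar> (center B) (outer B)"

text \<open>A pattern consists of its rings and its touching points.\<close>

record 'v pattern =
  ring_at :: "'v \<Rightarrow> ring"
  touching :: "'v \<Rightarrow> real^3"

definition orthogonal_ring_pattern :: "'v sgraph \<Rightarrow> 'v pattern \<Rightarrow> bool" where
  "orthogonal_ring_pattern S P \<longleftrightarrow>
     ring_at P \<in> extensional (sverts S \<union> cverts S) \<and> touching P \<in> extensional (black S) \<and>
     (\<forall>v \<in> sverts S \<union> cverts S. spherical_ring (ring_at P v)) \<and>
     (\<forall>v \<in> sverts S. \<forall>w \<in> cverts S. opposite (faces S) v w \<longrightarrow>
        orthogonal_rings (ring_at P v) (ring_at P w)) \<and>
     (\<forall>b \<in> black S. \<forall>v \<in> sverts S \<union> cverts S. adj (faces S) v b \<longrightarrow>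
        touching P b \<in> circle (center (ring_at P v))
          (if horizontal_edge S v b then \<bar>inner (ring_at P v)\<bar> else outer (ring_at P v))) \<and>
     (\<forall>v \<in> sverts S \<union> cverts S.
        (inner (ring_at P v) > 0 \<longrightarrow> ccw_at (faces S) v (center (ring_at P v)) (touching P)) \<and>
        (inner (ring_at P v) < 0 \<longrightarrow> cw_at (faces S) v (center (ring_at P v)) (touching P)))"

definition global_parameter :: "'v sgraph \<Rightarrow> 'v pattern \<Rightarrow> real \<Rightarrow> bool" where
  "global_parameter S P q \<longleftrightarrow>
     (\<forall>v \<in> sverts S \<union> cverts S. q * cos (inner (ring_at P v)) = cos (outer (ring_at P v)))"


section \<open>The correspondence\<close>

text \<open>Note that \<open>sgn x\<close> is the radial projection of \<open>x\<close> to the unit sphere.\<close>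

definition corresponds :: "'v sgraph \<Rightarrow> 'v net \<times> 'v net \<Rightarrow> 'v pattern \<Rightarrow> bool" where
  "corresponds S = (\<lambda>(Ns, Nc) P.
     (\<forall>v \<in> sverts S. center (ring_at P v) = sgn (vertex Ns v)) \<and>
     (\<forall>v \<in> cverts S. center (ring_at P v) = sgn (vertex Nc v)) \<and>
     (\<forall>b \<in> black S. touching P b = sgn (tangency Ns b) \<and> touching P b = sgn (tangency Nc b)))"

end

theory Submission
  imports Defs
begin

text \<open>
  Let \<open>q\<^sub>b\<close> be the direction of the point of tangency of \<open>b\<close>, \<open>k\<^sub>v\<close> a vertex of one of the nets and
  \<open>p\<^sub>v\<close> its direction. That the edge \<open>b\<close> touches a sphere of radius \<open>r\<close> at
  \<open>r *\<^sub>R q\<^sub>b\<close> says \<open>k\<^sub>v \<bullet> q\<^sub>b = r\<close>, and duality says \<open>k\<^sub>v \<bullet> k\<^sub>w = 1\<close> for opposite white vertices, as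
  \<open>rp * rm = 1\<close>. With \<open>cos r\<^sub>v = rp / norm k\<^sub>v\<close> and \<open>cos R\<^sub>v = rm / norm k\<^sub>v\<close> the first equation says that the
  circles of the ring pass through the touching points, and the second one is the spherical
  Pythagorean theorem \<open>p\<^sub>v \<bullet> p\<^sub>w = cos R\<^sub>v * cos r\<^sub>w\<close>, i.e. orthogonality of the rings. Regularity makes
  \<open>norm k\<^sub>v > rp\<close> and determines the sign of \<open>r\<^sub>v\<close>.
\<close>

section \<open>Vectors in three-space\<close>

lemma sgn_unit_scaled: "norm x = 1 \<Longrightarrow> 0 < c \<Longrightarrow> sgn (c *\<^sub>R x) = x"
  for x :: "'a::real_normed_vector"
  by (simp add: sgn_div_norm)

lemma norm_scaleR_sgn: "norm x *\<^sub>R sgn x = x" for x :: "'a::real_normed_vector"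
  by (cases "x = 0") (simp_all add: sgn_div_norm)

lemma sgn_idem: "sgn (sgn x) = sgn x" for x :: "'a::real_normed_vector"
  by (cases "x = 0") (simp_all add: sgn_div_norm)

lemma cross3_parallel:
  fixes e q x :: "real^3"
  assumes "norm q = 1" "e \<noteq> 0" "e \<bullet> q = 0" "x \<bullet> q = 0" "x \<bullet> e = 0"
  shows "\<exists>c. x = c *\<^sub>R cross3 q e"
proof -
  have "(norm (cross3 q e))\<^sup>2 = (norm e)\<^sup>2"
    using norm_cross[of q e] assms by (simp add: inner_commute)
  then have nz: "cross3 q e \<noteq> 0"
    using assms by auto
  have "cross3 x (cross3 q e) = 0"
    using assms by (simp add: Lagrange)
  then have "cross3 (cross3 q e) x = 0"
    by (subst cross_skew) simp
  then have "collinear {0, cross3 q e, x}"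
    by (simp add: cross_eq_0)
  then show ?thesis
    using nz by (metis collinear_lemma scaleR_zero_left)
qed

text \<open>In the plane orthogonal to \<open>q\<close> the orthogonal complement of a line is a line, so there are only
  two directions to alternate between.\<close>

lemma alternating_directions:
  fixes y :: "nat \<Rightarrow> real^3"
  assumes q: "norm q = 1"
    and y: "\<And>i. i < n \<Longrightarrow> y i \<noteq> 0 \<and> y i \<bullet> q = 0"
    and orth: "\<And>i. Suc i < n \<Longrightarrow> y i \<bullet> y (Suc i) = 0"
    and i: "i < n"
  shows "\<exists>c. y i = c *\<^sub>R (if even i then y 0 else cross3 q (y 0))"
  using i
proof (induction i)
  case 0
  then show ?case by (intro exI[of _ 1]) simp
next
  case (Suc i)
  then obtain c where c: "y i = c *\<^sub>R (if even i then y 0 else cross3 q (y 0))"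
    by auto
  have c0: "c \<noteq> 0" using y[of i] c Suc.prems by auto
  obtain d where d: "y (Suc i) = d *\<^sub>R cross3 q (y i)"
    using cross3_parallel[OF q, of "y i" "y (Suc i)"] y[of i] y[of "Suc i"] orth[of i] Suc.prems
    by (auto simp: inner_commute)
  show ?case
  proof (cases "even i")
    case True
    then show ?thesis using c d by (auto simp: cross_mult_right)
  next
    case False
    have "cross3 q (cross3 q (y 0)) = (q \<bullet> y 0) *\<^sub>R q - (q \<bullet> q) *\<^sub>R y 0"
      by (simp add: Lagrange)
    then have "cross3 q (cross3 q (y 0)) = - y 0"
      using q y[of 0] Suc.prems by (simp add: inner_commute norm_eq_1)
    then show ?thesis using c d False
      by (auto simp: cross_mult_right intro!: exI[of _ "- (d * c)"])
  qed
qed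


section \<open>Cyclic order around an axis\<close>

text \<open>The sine of the angle from \<open>x\<close> to \<open>y\<close>, both projected along \<open>a\<close>.\<close>

definition axial_sin :: "real^3 \<Rightarrow> real^3 \<Rightarrow> real^3 \<Rightarrow> real" where
  "axial_sin a x y = sgn a \<bullet> cross3 (sgn (x - (x \<bullet> sgn a) *\<^sub>R sgn a)) (sgn (y - (y \<bullet> sgn a) *\<^sub>R sgn a))"

lemma axial_sin_commute: "axial_sin a y x = - axial_sin a x y"
  unfolding axial_sin_def by (subst cross_skew) simp

lemma ccw_around_angles:
  assumes "ccw_around a xs"
  obtains \<theta> where
    "\<And>i j. i < length xs \<Longrightarrow> j < length xs \<Longrightarrow> axial_sin a (xs ! i) (xs ! j) = sin (\<theta> j - \<theta> i)"
    "\<And>i j. i < j \<Longrightarrow> j < length xs \<Longrightarrow> \<theta> i < \<theta> j \<and> \<theta> j < \<theta> i + 2 * pi"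
    "length xs = 2 \<Longrightarrow> \<theta> 1 < \<theta> 0 + pi"
proof -
  obtain e1 e2 h \<rho> \<theta> where e: "norm e1 = 1" "norm e2 = 1" "e1 \<bullet> e2 = 0" "cross3 e1 e2 = sgn a"
    and xs: "\<And>i. i < length xs \<Longrightarrow> 0 < \<rho> i \<and>
        xs ! i = h i *\<^sub>R sgn a + \<rho> i *\<^sub>R (cos (\<theta> i) *\<^sub>R e1 + sin (\<theta> i) *\<^sub>R e2)"
    and \<theta>: "\<And>i j. i < j \<Longrightarrow> j < length xs \<Longrightarrow> \<theta> i < \<theta> j \<and> \<theta> j < \<theta> i + 2 * pi"
      "length xs = 2 \<Longrightarrow> \<theta> 1 < \<theta> 0 + pi"
    using assms unfolding ccw_around_def by blast
  have ee: "e1 \<bullet> e1 = 1" "e2 \<bullet> e2 = 1" "e2 \<bullet> e1 = 0"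
    using e by (simp_all add: norm_eq_1 inner_commute)
  have ea: "e1 \<bullet> sgn a = 0" "e2 \<bullet> sgn a = 0"
    using e(4) by (metis dot_cross_self)+
  have "(norm (sgn a))\<^sup>2 = 1"
    using norm_cross[of e1 e2] e by simp
  then have aa: "sgn a \<bullet> sgn a = 1" by (simp add: power2_norm_eq_inner)
  define d where "d i = cos (\<theta> i) *\<^sub>R e1 + sin (\<theta> i) *\<^sub>R e2" for i
  have da: "d i \<bullet> sgn a = 0" for i
    using ea by (simp add: d_def inner_add_left)
  have nd: "norm (d i) = 1" for i
    unfolding norm_eq_1 d_def by (simp add: inner_add_left inner_add_right ee e(3) flip: power2_eq_square)
  have proj: "sgn (xs ! i - (xs ! i \<bullet> sgn a) *\<^sub>R sgn a) = d i" if "i < length xs" for i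
  proof -
    have "xs ! i - (xs ! i \<bullet> sgn a) *\<^sub>R sgn a = \<rho> i *\<^sub>R d i"
      using xs[OF that] by (simp add: d_def[symmetric] inner_add_left da aa)
    then show ?thesis using xs[OF that] nd[of i] by (simp add: sgn_scaleR sgn_div_norm)
  qed
  have "axial_sin a (xs ! i) (xs ! j) = sin (\<theta> j - \<theta> i)" if "i < length xs" "j < length xs" for i j
  proof -
    have "cross3 (d i) (d j) = (cos (\<theta> i) * sin (\<theta> j) - sin (\<theta> i) * cos (\<theta> j)) *\<^sub>R sgn a"
      unfolding d_def
      by (simp add: cross_add_left cross_add_right cross_mult_left cross_mult_right e(4)
            cross_skew[of e2 e1] algebra_simps)
    then have "sgn a \<bullet> cross3 (d i) (d j) = cos (\<theta> i) * sin (\<theta> j) - sin (\<theta> i) * cos (\<theta> j)"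
      by (simp add: aa)
    then show ?thesis
      using that by (simp add: axial_sin_def proj sin_diff)
  qed
  then show thesis using that \<theta> by blast
qed

lemma ccw_around_off_axis:
  assumes "ccw_around a xs" "x \<in> set xs" "a \<noteq> 0"
  shows "x \<bullet> a < norm x * norm a"
proof -
  obtain e1 e2 h \<rho> \<theta> where e: "norm e1 = 1" "norm e2 = 1" "e1 \<bullet> e2 = 0" "cross3 e1 e2 = sgn a"
    and xs: "\<And>i. i < length xs \<Longrightarrow> 0 < \<rho> i \<and>
        xs ! i = h i *\<^sub>R sgn a + \<rho> i *\<^sub>R (cos (\<theta> i) *\<^sub>R e1 + sin (\<theta> i) *\<^sub>R e2)"
    using assms unfolding ccw_around_def by blast
  obtain i where i: "i < length xs" "x = xs ! i"
    using assms by (metis in_set_conv_nth)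
  define d where "d = cos (\<theta> i) *\<^sub>R e1 + sin (\<theta> i) *\<^sub>R e2"
  have "d \<bullet> cross3 e1 e2 = 0" by (simp add: d_def inner_add_left dot_cross_self)
  then have da: "d \<bullet> a = 0"
    using e(4) \<open>a \<noteq> 0\<close> by (simp add: sgn_div_norm)
  have dd: "d \<bullet> d = 1" unfolding d_def
    using e by (simp add: inner_add_left inner_add_right norm_eq_1 inner_commute[of e2 e1]
        flip: power2_eq_square)
  have x: "x = h i *\<^sub>R sgn a + \<rho> i *\<^sub>R d" "\<rho> i > 0"
    using xs i d_def by auto
  have "a \<bullet> d = 0" using da by (simp add: inner_commute)
  then have "x \<bullet> d = \<rho> i" using dd
    unfolding x(1) by (simp add: inner_add_left sgn_div_norm)
  have "x \<bullet> a \<noteq> norm x * norm a"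
  proof
    assume "x \<bullet> a = norm x * norm a"
    then have "norm x *\<^sub>R a = norm a *\<^sub>R x"
      by (simp add: norm_cauchy_schwarz_eq)
    then have "norm a * (x \<bullet> d) = norm x * (a \<bullet> d)"
      by (metis inner_scaleR_left)
    then show False using \<open>x \<bullet> d = \<rho> i\<close> x \<open>a \<noteq> 0\<close> da by (simp add: inner_commute)
  qed
  then show ?thesis using norm_cauchy_schwarz[of x a] by simp
qed

lemma ccw_around_cong:
  assumes "ccw_around a xs" "sgn a = sgn b" "map sgn xs = map sgn ys"
  shows "ccw_around b ys"
proof -
  have len: "length xs = length ys" using assms(3) by (metis length_map)
  obtain e1 e2 h \<rho> \<theta> where e: "norm e1 = 1" "norm e2 = 1" "e1 \<bullet> e2 = 0" "cross3 e1 e2 = sgn a"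
    and xs: "\<And>i. i < length xs \<Longrightarrow> 0 < \<rho> i \<and>
        xs ! i = h i *\<^sub>R sgn a + \<rho> i *\<^sub>R (cos (\<theta> i) *\<^sub>R e1 + sin (\<theta> i) *\<^sub>R e2)"
    and \<theta>: "\<And>i j. i < j \<Longrightarrow> j < length xs \<Longrightarrow> \<theta> i < \<theta> j \<and> \<theta> j < \<theta> i + 2 * pi"
      "length xs = 2 \<Longrightarrow> \<theta> 1 < \<theta> 0 + pi"
    using assms unfolding ccw_around_def by blast
  have "\<exists>c>0. ys ! i = c *\<^sub>R xs ! i" if "i < length xs" for i
  proof (cases "xs ! i = 0")
    case True
    have "sgn (xs ! i) = sgn (ys ! i)" using assms(3) that len by (metis nth_map)
    then show ?thesis using True by (intro exI[of _ 1]) (simp add: sgn_zero_iff)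
  next
    case False
    have s: "sgn (xs ! i) = sgn (ys ! i)" using assms(3) that len by (metis nth_map)
    then have "ys ! i \<noteq> 0" using False by (metis sgn_zero_iff)
    have "ys ! i = norm (ys ! i) *\<^sub>R sgn (ys ! i)"
      using \<open>ys ! i \<noteq> 0\<close> by (simp add: sgn_div_norm)
    also have "\<dots> = norm (ys ! i) *\<^sub>R sgn (xs ! i)"
      by (simp only: s)
    also have "\<dots> = (norm (ys ! i) / norm (xs ! i)) *\<^sub>R xs ! i"
      by (simp only: sgn_div_norm scaleR_scaleR divide_inverse)
    finally show ?thesis
      using False[folded zero_less_norm_iff] \<open>ys ! i \<noteq> 0\<close>[folded zero_less_norm_iff]
        divide_pos_pos[of "norm (ys ! i)" "norm (xs ! i)"] by blast
  qed
  then obtain c where c: "\<And>i. i < length xs \<Longrightarrow> c i > 0 \<and> ys ! i = c i *\<^sub>R xs ! i"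
    by metis
  have "\<forall>i<length ys. 0 < c i * \<rho> i \<and>
      ys ! i = (c i * h i) *\<^sub>R sgn b + (c i * \<rho> i) *\<^sub>R (cos (\<theta> i) *\<^sub>R e1 + sin (\<theta> i) *\<^sub>R e2)"
  proof (intro allI impI)
    fix i assume "i < length ys"
    then have "i < length xs" using len by simp
    note x = xs[OF this] and y = c[OF this]
    have "ys ! i = c i *\<^sub>R (h i *\<^sub>R sgn a + \<rho> i *\<^sub>R (cos (\<theta> i) *\<^sub>R e1 + sin (\<theta> i) *\<^sub>R e2))"
      by (subst y[THEN conjunct2], subst x[THEN conjunct2], rule refl)
    also have "\<dots> = (c i * h i) *\<^sub>R sgn b + (c i * \<rho> i) *\<^sub>R (cos (\<theta> i) *\<^sub>R e1 + sin (\<theta> i) *\<^sub>R e2)"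
      by (simp only: scaleR_add_right scaleR_scaleR assms(2) mult.assoc)
    finally show "0 < c i * \<rho> i \<and>
      ys ! i = (c i * h i) *\<^sub>R sgn b + (c i * \<rho> i) *\<^sub>R (cos (\<theta> i) *\<^sub>R e1 + sin (\<theta> i) *\<^sub>R e2)"
      using x[THEN conjunct1] y[THEN conjunct1] by (intro conjI mult_pos_pos)
  qed
  moreover have "(\<forall>i j. i < j \<longrightarrow> j < length ys \<longrightarrow> \<theta> i < \<theta> j \<and> \<theta> j < \<theta> i + 2 * pi) \<and>
        (length ys = 2 \<longrightarrow> \<theta> (1::nat) < \<theta> 0 + pi)"
    using \<theta> len by simp
  moreover have "cross3 e1 e2 = sgn b" using e(4) assms(2) by simp
  ultimately show ?thesis
    unfolding ccw_around_def using e(1-3)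
    by (intro exI[of _ e1] exI[of _ e2] exI[of _ "\<lambda>i. c i * h i"] exI[of _ "\<lambda>i. c i * \<rho> i"]
        exI[of _ \<theta>] conjI) simp_all
qed

text \<open>Twice the signed area of the triangle with vertices at the three angles on the unit circle.\<close>

lemma sin_triangle_pos:
  fixes \<alpha> \<beta> \<gamma> :: real
  assumes "\<alpha> < \<beta>" "\<beta> < \<gamma>" "\<gamma> < \<alpha> + 2 * pi"
  shows "sin (\<beta> - \<alpha>) + sin (\<gamma> - \<beta>) + sin (\<alpha> - \<gamma>) > 0"
proof -
  define u v where "u = (\<beta> - \<alpha>) / 2" and "v = (\<gamma> - \<beta>) / 2"
  have pos: "sin u > 0" "sin v > 0" "sin (u + v) > 0"
    using assms by (auto intro!: sin_gt_zero simp: u_def v_def field_simps)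
  have "sin (\<beta> - \<alpha>) + sin (\<gamma> - \<beta>) + sin (\<alpha> - \<gamma>) = sin (2 * u) + sin (2 * v) - sin (2 * (u + v))"
  proof -
    have "\<beta> - \<alpha> = 2 * u" "\<gamma> - \<beta> = 2 * v" "\<alpha> - \<gamma> = - (2 * (u + v))"
      by (simp_all add: u_def v_def field_simps)
    then show ?thesis by (simp only: sin_minus)
  qed
  also have "\<dots> = 2 * sin u * cos u + 2 * sin v * cos v - 2 * sin (u + v) * cos (u + v)"
    by (simp only: sin_double)
  also have "\<dots> = 4 * sin u * sin v * sin (u + v)"
  proof -
    have "cos u * cos u = 1 - sin u * sin u" "cos v * cos v = 1 - sin v * sin v"
      using sin_cos_squared_add[of u] sin_cos_squared_add[of v] by (simp_all add: power2_eq_square)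
    then show ?thesis unfolding sin_add cos_add by algebra
  qed
  finally show ?thesis using pos by simp
qed

lemma not_ccw_around_and_cw_around:
  assumes "ccw_around a xs" "cw_around a xs" "2 \<le> length xs"
  shows False
proof -
  let ?n = "length xs" and ?A = "\<lambda>i j. axial_sin a (xs ! i) (xs ! j)"
  obtain \<theta> where \<theta>: "\<And>i j. i < ?n \<Longrightarrow> j < ?n \<Longrightarrow> ?A i j = sin (\<theta> j - \<theta> i)"
    "\<And>i j. i < j \<Longrightarrow> j < ?n \<Longrightarrow> \<theta> i < \<theta> j \<and> \<theta> j < \<theta> i + 2 * pi"
    "?n = 2 \<Longrightarrow> \<theta> 1 < \<theta> 0 + pi"
    using ccw_around_angles[OF assms(1)] by blast
  have "ccw_around a (rev xs)" using assms(2) by (simp add: cw_around_def)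
  from ccw_around_angles[OF this] obtain \<eta> where
    \<eta>: "\<And>i j. i < ?n \<Longrightarrow> j < ?n \<Longrightarrow> axial_sin a (rev xs ! i) (rev xs ! j) = sin (\<eta> j - \<eta> i)"
    "\<And>i j. i < j \<Longrightarrow> j < ?n \<Longrightarrow> \<eta> i < \<eta> j \<and> \<eta> j < \<eta> i + 2 * pi"
    "?n = 2 \<Longrightarrow> \<eta> 1 < \<eta> 0 + pi"
    by auto
  show False
  proof (cases "?n = 2")
    case True
    have "?A 0 1 > 0"
      using \<theta>(1)[of 0 1] \<theta>(2)[of 0 1] \<theta>(3) True by (auto intro!: sin_gt_zero)
    moreover have "?A 1 0 > 0"
      using \<eta>(1)[of 0 1] \<eta>(2)[of 0 1] \<eta>(3) True by (auto simp: rev_nth intro!: sin_gt_zero)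
    ultimately show False using axial_sin_commute[of a "xs ! 0" "xs ! 1"] by simp
  next
    case False
    then have "3 \<le> ?n" using assms(3) by simp
    then obtain m where "?n = 3 + m" using le_Suc_ex by blast
    then have n: "?n = Suc (Suc (Suc m))" by simp
    let ?k = m and ?l = "Suc m" and ?m = "Suc (Suc m)"
    have r: "rev xs ! 0 = xs ! ?m" "rev xs ! 1 = xs ! ?l" "rev xs ! 2 = xs ! ?k"
      by (simp_all add: rev_nth n)
    have "?A ?k ?l + ?A ?l ?m + ?A ?m ?k > 0"
      using sin_triangle_pos[of "\<theta> ?k" "\<theta> ?l" "\<theta> ?m"] \<theta>(1)[of ?k ?l] \<theta>(1)[of ?l ?m] \<theta>(1)[of ?m ?k]
        \<theta>(2)[of ?k ?l] \<theta>(2)[of ?l ?m] \<theta>(2)[of ?k ?m] n by simp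
    moreover have "?A ?m ?l + ?A ?l ?k + ?A ?k ?m > 0"
      using sin_triangle_pos[of "\<eta> 0" "\<eta> 1" "\<eta> 2"] \<eta>(1)[of 0 1] \<eta>(1)[of 1 2] \<eta>(1)[of 2 0]
        \<eta>(2)[of 0 1] \<eta>(2)[of 1 2] \<eta>(2)[of 0 2] n unfolding r by simp
    ultimately show False
      using axial_sin_commute[of a "xs ! ?k" "xs ! ?l"] axial_sin_commute[of a "xs ! ?l" "xs ! ?m"]
        axial_sin_commute[of a "xs ! ?m" "xs ! ?k"] by simp
  qed
qed


section \<open>Circles in the sphere\<close>

lemma circle_iff:
  assumes "norm p = 1" "0 \<le> r" "r \<le> pi"
  shows "x \<in> circle p r \<longleftrightarrow> norm x = 1 \<and> p \<bullet> x = cos r"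
proof -
  have "\<bar>p \<bullet> x\<bar> \<le> 1" if "norm x = 1"
    using Cauchy_Schwarz_ineq2[of p x] assms that by simp
  then show ?thesis
    using assms by (auto simp: circle_def cos_arccos_abs arccos_cos)
qed

lemma orthogonal_circles_iff:
  assumes "norm p = 1" "0 \<le> r" "r \<le> pi" "norm p' = 1" "0 \<le> r'" "r' \<le> pi"
  shows "orthogonal_circles p r p' r' \<longleftrightarrow>
    circle p r \<inter> circle p' r' \<noteq> {} \<and> p \<bullet> p' = cos r * cos r'"
proof -
  have "cross3 p x \<bullet> cross3 p' x = p \<bullet> p' - cos r * cos r'" if "x \<in> circle p r \<inter> circle p' r'" for x
    using that assms by (simp add: circle_iff dot_cross norm_eq_1 inner_commute[of x p'])
  then show ?thesis
    unfolding orthogonal_circles_def by auto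
qed


section \<open>Polar data of nets and patterns\<close>

lemma star_length: "star F v bs \<Longrightarrow> 2 \<le> length bs"
  by (auto simp: star_def closed_star_def open_star_def)

lemma star_consecutive: "star F v bs \<Longrightarrow> Suc i < length bs \<Longrightarrow> (bs ! i, bs ! Suc i) \<in> corners F v"
  by (auto simp: star_def closed_star_def open_star_def consecutive_def)

lemma star_corner:
  assumes "star F v bs" "(x, y) \<in> corners F v"
  shows "x \<in> set bs" "y \<in> set bs"
proof -
  have "bs \<noteq> []" using star_length[OF assms(1)] by auto
  moreover have "corners F v \<subseteq> insert (last bs, hd bs) (consecutive bs)"
    using assms(1) unfolding star_def closed_star_def open_star_def by blast
  then have "(x = last bs \<and> y = hd bs) \<or> (\<exists>i. Suc i < length bs \<and> x = bs ! i \<and> y = bs ! Suc i)"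
    using assms(2) unfolding consecutive_def by blast
  ultimately show "x \<in> set bs" "y \<in> set bs"
    using hd_in_set last_in_set nth_mem Suc_lessD by metis+
qed

locale coloured_s_quad_graph =
  fixes S :: "'v sgraph" and rp rm :: real
  assumes s_quad_graph: "s_quad_graph S"
    and alternating: "alternating_colouring S"
    and radii: "rm < rp" "0 < rm" "rp * rm = 1"
begin

abbreviation F where "F \<equiv> faces S"
abbreviation W where "W \<equiv> sverts S \<union> cverts S"

lemma rp_pos: "0 < rp"
  using radii by simp

lemma verts_eq: "verts F = black S \<union> W"
  using s_quad_graph by (simp add: s_quad_graph_def)

lemma quad_graph: "quad_graph F"
  using s_quad_graph by (simp add: s_quad_graph_def)

lemma rotate: "(a, b, c, d) \<in> F \<Longrightarrow> (b, c, d, a) \<in> F"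
  using quad_graph[unfolded quad_graph_def, THEN conjunct1] by blast

lemma obtain_star: assumes "v \<in> black S \<union> W" obtains bs where "star F v bs"
  using quad_graph[unfolded quad_graph_def, THEN conjunct2, THEN conjunct2, THEN conjunct1] assms
  unfolding verts_eq by blast

lemma black_white_disjoint: "v \<in> W \<Longrightarrow> v \<notin> black S"
  using s_quad_graph unfolding s_quad_graph_def by blast

lemma s_c_disjoint: "v \<in> cverts S \<Longrightarrow> v \<notin> sverts S"
  using s_quad_graph unfolding s_quad_graph_def by blast

lemma quad_vertex: "(a, b, c, d) \<in> F \<Longrightarrow> a \<in> black S \<union> W"
  unfolding verts_eq[symmetric] verts_def by blast

lemma quad_adj: "(a, b, c, d) \<in> F \<Longrightarrow> adj F a b \<and> adj F a d \<and> adj F b a \<and> adj F d a"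
  using rotate unfolding adj_def by blast

lemma adj_vertices: "adj F x y \<Longrightarrow> x \<in> black S \<union> W \<and> y \<in> black S \<union> W"
  unfolding adj_def using rotate quad_vertex by blast

lemma adj_black_iff: "adj F x y \<Longrightarrow> x \<in> black S \<longleftrightarrow> y \<notin> black S"
  using s_quad_graph unfolding s_quad_graph_def by blast

lemma adj_white: "adj F v b \<Longrightarrow> v \<in> W \<Longrightarrow> b \<in> black S"
  using adj_black_iff black_white_disjoint by blast

lemma adj_black: "adj F b v \<Longrightarrow> b \<in> black S \<Longrightarrow> v \<in> W"
  using adj_black_iff adj_vertices by blast

lemma adj_sym: "adj F x y \<Longrightarrow> adj F y x"
  unfolding adj_def by blast

lemma quad_types:
  assumes "(v, b, w, d) \<in> F" "v \<in> W"
  shows "b \<in> black S" "d \<in> black S" "w \<in> W" "v \<in> sverts S \<longleftrightarrow> w \<in> cverts S"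
    "b \<in> horizontal S \<longleftrightarrow> d \<notin> horizontal S"
proof -
  have adj: "adj F v b" "adj F v d" "adj F b w"
    using assms quad_adj rotate by blast+
  show b: "b \<in> black S" and "d \<in> black S"
    using adj adj_white assms(2) by blast+
  show w: "w \<in> W" using adj b adj_black by blast
  show vw: "v \<in> sverts S \<longleftrightarrow> w \<in> cverts S"
    using s_quad_graph assms black_white_disjoint unfolding s_quad_graph_def by blast
  have "(w, d, v, b) \<in> F" using assms rotate by blast
  then show "b \<in> horizontal S \<longleftrightarrow> d \<notin> horizontal S"
    using alternating assms vw w unfolding alternating_colouring_def by blast
qed

lemma star_adj:
  assumes "star F v bs" "b \<in> set bs"
  shows "adj F v b"
proof -
  obtain i where i: "i < length bs" "b = bs ! i" using assms(2) by (metis in_set_conv_nth)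
  have len: "2 \<le> length bs" using star_length assms(1) .
  have "(\<exists>y. (b, y) \<in> corners F v) \<or> (\<exists>x. (x, b) \<in> corners F v)"
  proof (cases "Suc i < length bs")
    case True
    then show ?thesis using star_consecutive[OF assms(1) True] i(2) by blast
  next
    case False
    then obtain j where "i = Suc j" using len i(1) by (cases i) simp_all
    then show ?thesis using star_consecutive[OF assms(1), of j] i by blast
  qed
  then show ?thesis unfolding corners_def using quad_adj by blast
qed

lemma adj_in_star:
  assumes "star F v bs" "adj F v b"
  shows "b \<in> set bs"
proof -
  obtain w d where "(v, b, w, d) \<in> F \<or> (b, v, w, d) \<in> F" using assms(2) unfolding adj_def by blast
  then have "(b, d) \<in> corners F v \<or> (w, b) \<in> corners F v"
    unfolding corners_def using rotate by blast
  then show ?thesis using star_corner[OF assms(1)] by blast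
qed

lemma obtain_quad_at:
  assumes "v \<in> black S \<union> W" obtains b w d where "(v, b, w, d) \<in> F"
proof -
  obtain bs where "star F v bs" using obtain_star assms by blast
  then have "(bs ! 0, bs ! Suc 0) \<in> corners F v"
    using star_consecutive[of F v bs 0] star_length[of F v bs] by simp
  then show thesis using that unfolding corners_def by auto
qed

lemma obtain_horizontal_edge:
  assumes "v \<in> W" obtains b where "adj F v b" "horizontal_edge S v b"
proof -
  obtain b w d where q: "(v, b, w, d) \<in> F" using obtain_quad_at assms by blast
  have "horizontal_edge S v b \<or> horizontal_edge S v d"
    using quad_types(5)[OF q assms] by (simp add: horizontal_edge_def)
  then show thesis
    using that quad_adj[OF q] by blast
qed

lemma horizontal_edge_quad:
  assumes "(v, b, w, d) \<in> F" "v \<in> W"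
  shows "horizontal_edge S v b \<longleftrightarrow> \<not> horizontal_edge S v d"
    "horizontal_edge S w b \<longleftrightarrow> \<not> horizontal_edge S v b"
    "horizontal_edge S w d \<longleftrightarrow> \<not> horizontal_edge S v d"
  using quad_types[OF assms] assms(2) s_c_disjoint unfolding horizontal_edge_def by auto

definition radius :: "'v \<Rightarrow> 'v \<Rightarrow> real" where
  "radius v b = (if horizontal_edge S v b then rp else rm)"

lemma radius_pos: "radius v b > 0"
  using radii rp_pos by (simp add: radius_def)

lemma radius_quad:
  assumes "(v, b, w, d) \<in> F" "v \<in> W"
  shows "radius v b * radius w b = 1"
  using horizontal_edge_quad[OF assms] radii by (auto simp: radius_def mult.commute)

text \<open>What nets and patterns have in common: \<open>k v\<close> is a vertex of one of the nets, and \<open>q b\<close> is the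
  touching point of \<open>b\<close>.\<close>

definition polar_data :: "(('v \<Rightarrow> real^3) \<times> ('v \<Rightarrow> real^3)) set" where
  "polar_data = {(k, q). k \<in> extensional W \<and> q \<in> extensional (black S) \<and>
     (\<forall>b\<in>black S. norm (q b) = 1) \<and>
     (\<forall>v\<in>W. \<forall>b. adj F v b \<longrightarrow> k v \<bullet> q b = radius v b) \<and>
     (\<forall>v\<in>W. \<forall>w. opposite F v w \<longrightarrow> k v \<bullet> k w = 1) \<and>
     (\<forall>v\<in>W. ccw_at F v (k v) q \<or> cw_at F v (k v) q)}"

lemma ccw_at_cong:
  assumes "sgn a = sgn a'" "\<And>b. adj F v b \<Longrightarrow> sgn (x b) = sgn (y b)"
  shows "ccw_at F v a x = ccw_at F v a' y" "cw_at F v a x = cw_at F v a' y"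
proof -
  have "ccw_around a (map x bs) = ccw_around a' (map y bs)"
    "ccw_around a (rev (map x bs)) = ccw_around a' (rev (map y bs))" if "star F v bs" for bs
  proof -
    have eq: "map sgn (map x bs) = map sgn (map y bs)"
      using star_adj[OF that] assms(2) by simp
    then have eq': "map sgn (rev (map x bs)) = map sgn (rev (map y bs))"
      by (simp only: rev_map[symmetric])
    show "ccw_around a (map x bs) = ccw_around a' (map y bs)"
      using ccw_around_cong[OF _ assms(1) eq] ccw_around_cong[OF _ assms(1)[symmetric] eq[symmetric]]
      by blast
    show "ccw_around a (rev (map x bs)) = ccw_around a' (rev (map y bs))"
      using ccw_around_cong[OF _ assms(1) eq'] ccw_around_cong[OF _ assms(1)[symmetric] eq'[symmetric]]
      by blast
  qed
  then show "ccw_at F v a x = ccw_at F v a' y" "cw_at F v a x = cw_at F v a' y"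
    unfolding ccw_at_def cw_at_def cw_around_def by simp_all
qed

lemma not_ccw_at_and_cw_at:
  assumes "v \<in> black S \<union> W" "ccw_at F v a x" "cw_at F v a x"
  shows False
proof -
  obtain bs where bs: "star F v bs" using obtain_star assms(1) .
  then show False
    using assms not_ccw_around_and_cw_around[of a "map x bs"] star_length[OF bs]
    unfolding ccw_at_def cw_at_def by auto
qed

lemma polar_data_norm:
  assumes "(k, q) \<in> polar_data" "v \<in> W"
  shows "rp < norm (k v)"
proof -
  obtain b where b: "adj F v b" "horizontal_edge S v b" using obtain_horizontal_edge assms(2) .
  then have "b \<in> black S" using adj_white assms(2) by blast
  with b assms have q: "norm (q b) = 1" "k v \<bullet> q b = rp"
    unfolding polar_data_def by (auto simp: radius_def)
  then have "k v \<noteq> 0" using rp_pos by auto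
  obtain bs where bs: "star F v bs" using obtain_star assms(2) by blast
  then have "q b \<in> set (map q bs)" using adj_in_star b by auto
  moreover have "ccw_around (k v) (map q bs) \<or> ccw_around (k v) (rev (map q bs))"
    using assms bs unfolding polar_data_def ccw_at_def cw_at_def cw_around_def by blast
  ultimately have "q b \<bullet> k v < norm (q b) * norm (k v)"
    using ccw_around_off_axis[OF _ _ \<open>k v \<noteq> 0\<close>] by (metis set_rev)
  then show ?thesis
    using q by (simp add: inner_commute)
qed

text \<open>The vectors \<open>k v - radius v b *\<^sub>R q b\<close>, for \<open>v\<close> adjacent to \<open>b\<close>, are nonzero, tangent at \<open>q b\<close>,
  and orthogonal for opposite vertices. A black boundary vertex may have more than four neighbours,
  hence the induction along its star.\<close>

lemma polar_data_directions:
  assumes kq: "(k, q) \<in> polar_data" and b: "b \<in> black S"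
  obtains u u' where "u \<noteq> 0" "u' \<noteq> 0" "u \<bullet> q b = 0" "u' \<bullet> q b = 0" "u \<bullet> u' = 0"
    "\<And>v. v \<in> sverts S \<Longrightarrow> adj F v b \<Longrightarrow> \<exists>x. k v = radius v b *\<^sub>R q b + x *\<^sub>R u"
    "\<And>v. v \<in> cverts S \<Longrightarrow> adj F v b \<Longrightarrow> \<exists>x. k v = radius v b *\<^sub>R q b + x *\<^sub>R u'"
proof -
  obtain vs where vs: "star F b vs" using obtain_star b by blast
  have q: "norm (q b) = 1" using kq b unfolding polar_data_def by auto
  define y where "y i = k (vs ! i) - radius (vs ! i) b *\<^sub>R q b" for i
  let ?n = "length vs"
  have W: "vs ! i \<in> W" "adj F (vs ! i) b" if "i < ?n" for i
    using star_adj[OF vs nth_mem[OF that]] adj_black b adj_sym by blast+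
  have kqr: "k (vs ! i) \<bullet> q b = radius (vs ! i) b" if "i < ?n" for i
    using kq W[OF that] unfolding polar_data_def by blast
  have y: "y i \<noteq> 0 \<and> y i \<bullet> q b = 0" if "i < ?n" for i
  proof
    show "y i \<noteq> 0"
    proof
      assume "y i = 0"
      then have "norm (k (vs ! i)) = radius (vs ! i) b"
        using q radius_pos[of "vs ! i" b] by (simp add: y_def)
      then show False
        using polar_data_norm[OF kq W(1)[OF that]] radii(1) by (simp add: radius_def split: if_splits)
    qed
    show "y i \<bullet> q b = 0"
      using q kqr[OF that] by (simp add: y_def inner_diff_left norm_eq_1)
  qed
  have step: "y i \<bullet> y (Suc i) = 0 \<and> (vs ! i \<in> sverts S \<longleftrightarrow> vs ! Suc i \<notin> sverts S)"
    if i: "Suc i < ?n" for i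
  proof -
    obtain d where "(b, vs ! i, d, vs ! Suc i) \<in> F"
      using star_consecutive[OF vs i] unfolding corners_def by blast
    then have quad: "(vs ! i, d, vs ! Suc i, b) \<in> F" "(vs ! Suc i, b, vs ! i, d) \<in> F"
      using rotate by blast+
    then have "opposite F (vs ! i) (vs ! Suc i)"
      unfolding opposite_def by blast
    then have "k (vs ! i) \<bullet> k (vs ! Suc i) = 1"
      using kq W(1)[of i] i unfolding polar_data_def by simp
    then have "y i \<bullet> y (Suc i) = 1 - radius (vs ! Suc i) b * radius (vs ! i) b"
      using kqr[of i] kqr[OF i] i q inner_commute[of "q b" "k (vs ! Suc i)"]
      by (simp add: y_def inner_diff_left inner_diff_right norm_eq_1)
    then have "y i \<bullet> y (Suc i) = 0"
      using radius_quad[OF quad(2) W(1)[OF i]] by simp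
    moreover have "vs ! i \<in> sverts S \<longleftrightarrow> vs ! Suc i \<in> cverts S"
      using quad_types(4)[OF quad(1) W(1)] i by simp
    ultimately show ?thesis
      using W(1)[OF i] s_c_disjoint by blast
  qed
  have parity: "vs ! i \<in> sverts S \<longleftrightarrow> (even i \<longleftrightarrow> vs ! 0 \<in> sverts S)" if "i < ?n" for i
    using that
  proof (induction i)
    case (Suc i)
    then show ?case using step[of i] by auto
  qed simp
  have dirs: "\<exists>c. y i = c *\<^sub>R (if even i then y 0 else cross3 (q b) (y 0))" if "i < ?n" for i
    using alternating_directions[OF q, of ?n y i] y step that by blast
  have n: "0 < ?n" "Suc 0 < ?n" using star_length[OF vs] by auto
  have nz: "cross3 (q b) (y 0) \<noteq> 0"
    using dirs[of 1] y[of 1] n by auto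
  define u where "u = (if vs ! 0 \<in> sverts S then y 0 else cross3 (q b) (y 0))"
  define u' where "u' = (if vs ! 0 \<in> sverts S then cross3 (q b) (y 0) else y 0)"
  have main: "\<exists>x. k v = radius v b *\<^sub>R q b + x *\<^sub>R (if v \<in> sverts S then u else u')"
    if "adj F v b" for v
  proof -
    have "v \<in> set vs" using adj_in_star[OF vs] adj_sym that by blast
    then obtain i where i: "i < ?n" "v = vs ! i" by (metis in_set_conv_nth)
    obtain c where "y i = c *\<^sub>R (if even i then y 0 else cross3 (q b) (y 0))"
      using dirs[OF i(1)] ..
    then have "y i = c *\<^sub>R (if v \<in> sverts S then u else u')"
      using parity[OF i(1)] i(2) by (simp add: u_def u'_def)
    moreover have "k v = radius v b *\<^sub>R q b + y i" using i by (simp add: y_def)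
    ultimately show ?thesis by metis
  qed
  have "cross3 (q b) (y 0) \<bullet> q b = 0" "cross3 (q b) (y 0) \<bullet> y 0 = 0"
    "y 0 \<bullet> cross3 (q b) (y 0) = 0"
    by (simp_all add: dot_cross_self)
  then have "u \<noteq> 0" "u' \<noteq> 0" "u \<bullet> q b = 0" "u' \<bullet> q b = 0" "u \<bullet> u' = 0"
    using y[of 0] n nz by (simp_all add: u_def u'_def)
  moreover have "\<exists>x. k v = radius v b *\<^sub>R q b + x *\<^sub>R u" if "v \<in> sverts S" "adj F v b" for v
    using main[OF that(2)] that(1) by simp
  moreover have "\<exists>x. k v = radius v b *\<^sub>R q b + x *\<^sub>R u'" if "v \<in> cverts S" "adj F v b" for v
    using main[OF that(2)] s_c_disjoint[OF that(1)] by simp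
  ultimately show thesis by (rule that)
qed


section \<open>Nets and polar data\<close>

definition nets_of :: "('v \<Rightarrow> real^3) \<times> ('v \<Rightarrow> real^3) \<Rightarrow> 'v net \<times> 'v net" where
  "nets_of = (\<lambda>(k, q).
     (\<lparr>vertex = restrict k (sverts S),
       tangency = (\<lambda>b\<in>black S. (if b \<in> horizontal S then rp else rm) *\<^sub>R q b)\<rparr>,
      \<lparr>vertex = restrict k (cverts S),
       tangency = (\<lambda>b\<in>black S. (if b \<in> black S - horizontal S then rp else rm) *\<^sub>R q b)\<rparr>))"

definition data_of_nets :: "'v net \<times> 'v net \<Rightarrow> ('v \<Rightarrow> real^3) \<times> ('v \<Rightarrow> real^3)" where
  "data_of_nets = (\<lambda>(Ns, Nc).
     (\<lambda>v\<in>W. if v \<in> sverts S then vertex Ns v else vertex Nc v,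
      \<lambda>b\<in>black S. sgn (tangency Ns b)))"

lemma radius_sverts: "v \<in> sverts S \<Longrightarrow> radius v b = (if b \<in> horizontal S then rp else rm)"
  by (simp add: radius_def horizontal_edge_def)

lemma radius_cverts:
  "v \<in> cverts S \<Longrightarrow> b \<in> black S \<Longrightarrow> radius v b = (if b \<in> black S - horizontal S then rp else rm)"
  using s_c_disjoint by (simp add: radius_def horizontal_edge_def)

lemma opposite_sym: "opposite F v w \<Longrightarrow> opposite F w v"
  unfolding opposite_def using rotate by blast

lemma opposite_white: "opposite F v w \<Longrightarrow> v \<in> W \<Longrightarrow> w \<in> W \<and> (v \<in> sverts S \<longleftrightarrow> w \<in> cverts S)"
  unfolding opposite_def using quad_types by blast

lemma koebe_net_of_data:
  fixes r :: "'v \<Rightarrow> real"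
  assumes kq: "(k, q) \<in> polar_data"
    and W: "W1 \<subseteq> W" "W2 \<subseteq> W"
    and r: "\<And>b. r b = (if b \<in> H then rp else rm)"
    and r2: "\<And>f b. f \<in> W2 \<Longrightarrow> adj F f b \<Longrightarrow> radius f b * r b = 1"
    and u: "\<And>b. b \<in> black S \<Longrightarrow> u b \<noteq> 0 \<and> u b \<bullet> q b = 0 \<and>
        (\<forall>v\<in>W1. adj F v b \<longrightarrow> (\<exists>x. k v = r b *\<^sub>R q b + x *\<^sub>R u b))"
  defines "N \<equiv> \<lparr>vertex = restrict k W1, tangency = (\<lambda>b\<in>black S. r b *\<^sub>R q b)\<rparr>"
  shows "f \<in> W2 \<Longrightarrow> normal_of (k f) (face_points S W1 N f)"
    and "b \<in> black S \<Longrightarrow> edge_direction S W1 N b (u b)"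
    and "koebe_net S W1 W2 H rp rm N"
proof -
  show normal: "normal_of (k f) (face_points S W1 N f)" if f: "f \<in> W2" for f
    unfolding normal_of_def
  proof
    have "f \<in> W" using f W by blast
    show "k f \<noteq> 0" using polar_data_norm[OF kq \<open>f \<in> W\<close>] rp_pos by auto
    have "k f \<bullet> x = 1" if "x \<in> face_points S W1 N f" for x
    proof -
      consider (v) v where "v \<in> W1" "opposite F v f" "x = k v"
        | (b) b where "adj F f b" "x = r b *\<^sub>R q b"
        using \<open>x \<in> _\<close> adj_white[OF _ \<open>f \<in> W\<close>] unfolding face_points_def N_def by auto
      then show ?thesis
      proof cases
        case v
        then show ?thesis using kq \<open>f \<in> W\<close> opposite_sym[of v f] unfolding polar_data_def by auto
      next
        case b
        then have "k f \<bullet> q b = radius f b" using kq \<open>f \<in> W\<close> unfolding polar_data_def by blast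
        then show ?thesis using r2[OF f b(1)] b(2) by (simp add: mult.commute)
      qed
    qed
    then show "\<exists>c. face_points S W1 N f \<subseteq> {x. k f \<bullet> x = c}" by blast
  qed
  show dir: "edge_direction S W1 N b (u b)" if "b \<in> black S" for b
    using u[OF that] that unfolding edge_direction_def N_def by auto
  have "edge_touches S W1 N b (if b \<in> H then rp else rm)" if "b \<in> black S" for b
    unfolding edge_touches_def
  proof
    have "norm (q b) = 1" using kq that unfolding polar_data_def by auto
    then show "norm (tangency N b) = (if b \<in> H then rp else rm)"
      using that radii rp_pos by (simp add: N_def r)
    show "\<exists>u. edge_direction S W1 N b u \<and> u \<bullet> tangency N b = 0"
      using dir[OF that] u[OF that] that by (intro exI[of _ "u b"]) (simp add: N_def)
  qed
  then show "koebe_net S W1 W2 H rp rm N"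
    unfolding koebe_net_def using normal by (auto simp: N_def)
qed

lemma nets_of_polar_data:
  assumes kq: "(k, q) \<in> polar_data"
  shows "dual_koebe_pair S rp rm (nets_of (k, q)) \<and> regular_pair S (nets_of (k, q))"
proof -
  define rs rc :: "'v \<Rightarrow> real"
    where "rs b = (if b \<in> horizontal S then rp else rm)"
      and "rc b = (if b \<in> black S - horizontal S then rp else rm)" for b
  define Ns where "Ns = \<lparr>vertex = restrict k (sverts S), tangency = (\<lambda>b\<in>black S. rs b *\<^sub>R q b)\<rparr>"
  define Nc where "Nc = \<lparr>vertex = restrict k (cverts S), tangency = (\<lambda>b\<in>black S. rc b *\<^sub>R q b)\<rparr>"
  have nets: "nets_of (k, q) = (Ns, Nc)"
    by (simp add: nets_of_def Ns_def Nc_def rs_def rc_def)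
  have q: "norm (q b) = 1" if "b \<in> black S" for b
    using kq that unfolding polar_data_def by auto
  have r_pos: "rs b > 0" "rc b > 0" for b
    using radii rp_pos by (simp_all add: rs_def rc_def)
  have rs: "radius v b = rs b" if "v \<in> sverts S" for v b
    using radius_sverts[OF that] by (simp add: rs_def)
  have rc: "radius v b = rc b" if "v \<in> cverts S" "adj F v b" for v b
    using radius_cverts[of v b] adj_white[of v b] that by (simp add: rc_def)
  have rsc: "rs b * rc b = 1" "rs b \<noteq> rc b" if "b \<in> black S" for b
    using radii that by (auto simp: rs_def rc_def mult.commute)
  have "\<exists>u u'. u \<noteq> 0 \<and> u' \<noteq> 0 \<and> u \<bullet> q b = 0 \<and> u' \<bullet> q b = 0 \<and> u \<bullet> u' = 0 \<and>
      (\<forall>v\<in>sverts S. adj F v b \<longrightarrow> (\<exists>x. k v = rs b *\<^sub>R q b + x *\<^sub>R u)) \<and>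
      (\<forall>v\<in>cverts S. adj F v b \<longrightarrow> (\<exists>x. k v = rc b *\<^sub>R q b + x *\<^sub>R u'))" if "b \<in> black S" for b
    using polar_data_directions[OF kq that] rs rc by metis
  then obtain u u' where u: "\<And>b. b \<in> black S \<Longrightarrow> u b \<noteq> 0 \<and> u b \<bullet> q b = 0 \<and>
        (\<forall>v\<in>sverts S. adj F v b \<longrightarrow> (\<exists>x. k v = rs b *\<^sub>R q b + x *\<^sub>R u b))"
      "\<And>b. b \<in> black S \<Longrightarrow> u' b \<noteq> 0 \<and> u' b \<bullet> q b = 0 \<and>
        (\<forall>v\<in>cverts S. adj F v b \<longrightarrow> (\<exists>x. k v = rc b *\<^sub>R q b + x *\<^sub>R u' b))"
      "\<And>b. b \<in> black S \<Longrightarrow> u b \<bullet> u' b = 0"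
    by metis
  have r2: "radius f b * rs b = 1" if "f \<in> cverts S" "adj F f b" for f b
    using rc[OF that] rsc(1)[OF adj_white[OF that(2)]] that(1) by (simp add: mult.commute)
  have r2': "radius f b * rc b = 1" if "f \<in> sverts S" "adj F f b" for f b
    using rs[OF that(1)] rsc(1)[OF adj_white[OF that(2)]] that(1) by simp
  have s: "f \<in> cverts S \<Longrightarrow> normal_of (k f) (face_points S (sverts S) Ns f)"
      "b \<in> black S \<Longrightarrow> edge_direction S (sverts S) Ns b (u b)"
      "koebe_net S (sverts S) (cverts S) (horizontal S) rp rm Ns" for f b
    unfolding Ns_def
    by (rule koebe_net_of_data[OF kq _ _ rs_def r2 u(1)]; blast)+
  have c: "f \<in> sverts S \<Longrightarrow> normal_of (k f) (face_points S (cverts S) Nc f)"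
      "b \<in> black S \<Longrightarrow> edge_direction S (cverts S) Nc b (u' b)"
      "koebe_net S (cverts S) (sverts S) (black S - horizontal S) rp rm Nc" for f b
    unfolding Nc_def
    by (rule koebe_net_of_data[OF kq _ _ rc_def r2' u(2)]; blast)+
  have tangency: "tangency Ns b = rs b *\<^sub>R q b" "tangency Nc b = rc b *\<^sub>R q b" if "b \<in> black S" for b
    using that by (simp_all add: Ns_def Nc_def)
  have sgn_tangency: "sgn (tangency Ns b) = q b" "sgn (tangency Nc b) = q b" if "b \<in> black S" for b
    using that q r_pos by (simp_all add: tangency sgn_unit_scaled)
  have norm_tangency: "norm (tangency Ns b) = rs b" "norm (tangency Nc b) = rc b" if "b \<in> black S" for b
    using that q[of b] r_pos[of b] by (simp_all add: tangency)
  have "dual_koebe_pair S rp rm (Ns, Nc)"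
    unfolding dual_koebe_pair_def prod.case
  proof (intro conjI ballI)
    show "normal_of (vertex Ns v) (face_points S (cverts S) Nc v)" if "v \<in> sverts S" for v
      using c(1)[OF that] that by (simp add: Ns_def)
    show "normal_of (vertex Nc v) (face_points S (sverts S) Ns v)" if "v \<in> cverts S" for v
      using s(1)[OF that] that by (simp add: Nc_def)
    show "\<exists>u u'. edge_direction S (sverts S) Ns b u \<and> edge_direction S (cverts S) Nc b u' \<and> u \<bullet> u' = 0"
      if "b \<in> black S" for b
      using s(2) c(2) u(3) that by blast
  qed (use s(3) c(3) sgn_tangency norm_tangency rsc(2) in simp_all)
  moreover have "regular_at S Ns v" if "v \<in> sverts S" for v
  proof -
    have "ccw_at F v (k v) q \<or> cw_at F v (k v) q" using kq that unfolding polar_data_def by auto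
    moreover have "sgn (q b) = sgn (tangency Ns b)" if "adj F v b" for b
      using sgn_tangency[of b] q[of b] adj_white[OF that] \<open>v \<in> _\<close> by (simp add: sgn_div_norm)
    moreover have "sgn (k v) = sgn (vertex Ns v)" using that by (simp add: Ns_def)
    ultimately show ?thesis
      unfolding regular_at_def using ccw_at_cong[of "k v" "vertex Ns v" v q "tangency Ns"] by blast
  qed
  moreover have "regular_at S Nc v" if "v \<in> cverts S" for v
  proof -
    have "ccw_at F v (k v) q \<or> cw_at F v (k v) q" using kq that unfolding polar_data_def by auto
    moreover have "sgn (q b) = sgn (tangency Nc b)" if "adj F v b" for b
      using sgn_tangency[of b] q[of b] adj_white[OF that] \<open>v \<in> _\<close> by (simp add: sgn_div_norm)
    moreover have "sgn (k v) = sgn (vertex Nc v)" using that by (simp add: Nc_def)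
    ultimately show ?thesis
      unfolding regular_at_def using ccw_at_cong[of "k v" "vertex Nc v" v q "tangency Nc"] by blast
  qed
  ultimately show ?thesis
    unfolding nets regular_pair_def by simp
qed

lemma koebe_net_products:
  assumes N: "koebe_net S W1 W2 H rp rm N" and v: "v \<in> W1" "v \<in> W"
    and normal: "normal_of (vertex N v) (face_points S W2 N' v)"
    and dual: "\<And>b. b \<in> black S \<Longrightarrow>
        norm (tangency N b) * norm (tangency N' b) = 1 \<and> sgn (tangency N b) = sgn (tangency N' b)"
  shows "adj F v b \<Longrightarrow> vertex N v \<bullet> sgn (tangency N b) = norm (tangency N b)"
    and "opposite F v w \<Longrightarrow> w \<in> W2 \<Longrightarrow> vertex N v \<bullet> vertex N' w = 1"
proof -
  show 1: "vertex N v \<bullet> sgn (tangency N b) = norm (tangency N b)" if b: "adj F v b" for b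
  proof -
    have "b \<in> black S" using adj_white b v(2) by blast
    then obtain u x where u: "u \<bullet> tangency N b = 0" "vertex N v = tangency N b + x *\<^sub>R u"
      using N b v(1) unfolding koebe_net_def edge_touches_def edge_direction_def by metis
    then have "vertex N v \<bullet> tangency N b = norm (tangency N b) * norm (tangency N b)"
      by (simp add: inner_add_left power2_norm_eq_inner flip: power2_eq_square)
    then show ?thesis
      by (cases "tangency N b = 0") (simp_all add: sgn_div_norm)
  qed
  show "vertex N v \<bullet> vertex N' w = 1" if w: "opposite F v w" "w \<in> W2" for w
  proof -
    obtain b d where "(v, b, w, d) \<in> F" using w(1) unfolding opposite_def by blast
    then have b: "adj F v b" "b \<in> black S" using quad_adj quad_types(1) v(2) by blast+
    obtain c where c: "\<And>x. x \<in> face_points S W2 N' v \<Longrightarrow> vertex N v \<bullet> x = c"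
      using normal unfolding normal_of_def by blast
    have "tangency N' b = norm (tangency N' b) *\<^sub>R sgn (tangency N b)"
      using dual[OF b(2)] norm_scaleR_sgn by metis
    then have "vertex N v \<bullet> tangency N' b = norm (tangency N' b) * norm (tangency N b)"
      using 1[OF b(1)] by (metis inner_scaleR_right)
    moreover have "vertex N v \<bullet> tangency N' b = c"
      using c b(1) unfolding face_points_def by blast
    moreover have "vertex N v \<bullet> vertex N' w = c"
      using c opposite_sym[OF w(1)] w(2) unfolding face_points_def by blast
    ultimately show ?thesis using dual[OF b(2)] by (simp add: mult.commute)
  qed
qed

context
  fixes Ns Nc :: "'v net"
  assumes pair: "dual_koebe_pair S rp rm (Ns, Nc)" and regular: "regular_pair S (Ns, Nc)"
begin

lemma koebe: "koebe_net S (sverts S) (cverts S) (horizontal S) rp rm Ns"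
    "koebe_net S (cverts S) (sverts S) (black S - horizontal S) rp rm Nc"
  using pair by (simp_all add: dual_koebe_pair_def)

lemma norm_tangency:
  assumes "b \<in> black S"
  shows "norm (tangency Ns b) = (if b \<in> horizontal S then rp else rm)"
    "norm (tangency Nc b) = (if b \<in> black S - horizontal S then rp else rm)"
  using koebe assms unfolding koebe_net_def edge_touches_def by blast+

lemma sgn_tangency: "b \<in> black S \<Longrightarrow> sgn (tangency Nc b) = sgn (tangency Ns b)"
  using pair by (simp add: dual_koebe_pair_def)

lemma tangency_dual:
  assumes "b \<in> black S"
  shows "norm (tangency Ns b) * norm (tangency Nc b) = 1 \<and> sgn (tangency Ns b) = sgn (tangency Nc b)"
    "norm (tangency Nc b) * norm (tangency Ns b) = 1 \<and> sgn (tangency Nc b) = sgn (tangency Ns b)"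
  using norm_tangency[OF assms] sgn_tangency[OF assms] radii assms by (auto simp: mult.commute)

lemma data_of_nets_polar: "data_of_nets (Ns, Nc) \<in> polar_data"
proof -
  define k where "k = (\<lambda>v\<in>W. if v \<in> sverts S then vertex Ns v else vertex Nc v)"
  define q where "q = (\<lambda>b\<in>black S. sgn (tangency Ns b))"
  have data: "data_of_nets (Ns, Nc) = (k, q)" by (simp add: data_of_nets_def k_def q_def)
  have k: "v \<in> sverts S \<Longrightarrow> k v = vertex Ns v" "v \<in> cverts S \<Longrightarrow> k v = vertex Nc v" for v
    using s_c_disjoint by (auto simp: k_def)
  have q: "q b = sgn (tangency Ns b)" "q b = sgn (tangency Nc b)" if "b \<in> black S" for b
    using sgn_tangency that by (simp_all add: q_def)
  have normal: "v \<in> sverts S \<Longrightarrow> normal_of (vertex Ns v) (face_points S (cverts S) Nc v)"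
      "v \<in> cverts S \<Longrightarrow> normal_of (vertex Nc v) (face_points S (sverts S) Ns v)" for v
    using pair by (simp_all add: dual_koebe_pair_def)
  have "norm (q b) = 1" if "b \<in> black S" for b
  proof -
    have "tangency Ns b \<noteq> 0" using tangency_dual(1)[OF that] by auto
    then show ?thesis using q(1)[OF that] by (simp add: norm_sgn)
  qed
  moreover have "k v \<bullet> q b = radius v b" if v: "v \<in> W" and b: "adj F v b" for v b
  proof (cases "v \<in> sverts S")
    case True
    then show ?thesis
      using koebe_net_products(1)[OF koebe(1) True v normal(1)[OF True] tangency_dual(1) b]
        adj_white[OF b v] norm_tangency by (simp add: k q(1) radius_sverts)
  next
    case False
    then have c: "v \<in> cverts S" using v by blast
    then show ?thesis
      using koebe_net_products(1)[OF koebe(2) c v normal(2)[OF c] tangency_dual(2) b]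
        adj_white[OF b v] norm_tangency by (simp add: k q(2) radius_cverts)
  qed
  moreover have "k v \<bullet> k w = 1" if v: "v \<in> W" and w: "opposite F v w" for v w
  proof (cases "v \<in> sverts S")
    case True
    then have "w \<in> cverts S" using opposite_white[OF w v] by blast
    then show ?thesis
      using koebe_net_products(2)[OF koebe(1) True v normal(1)[OF True] tangency_dual(1) w] True
      by (simp add: k)
  next
    case False
    then have c: "v \<in> cverts S" and "w \<in> sverts S" using v opposite_white[OF w v] by blast+
    then show ?thesis
      using koebe_net_products(2)[OF koebe(2) c v normal(2)[OF c] tangency_dual(2) w]
      by (simp add: k)
  qed
  moreover have "ccw_at F v (k v) q \<or> cw_at F v (k v) q" if v: "v \<in> W" for v
  proof (cases "v \<in> sverts S")
    case True
    have "sgn (tangency Ns b) = sgn (q b)" if "adj F v b" for b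
      using q(1) adj_white[OF that v] by (simp add: sgn_idem)
    then show ?thesis
      using regular True ccw_at_cong[of "k v" "k v" v "tangency Ns" q] k(1)[OF True]
      unfolding regular_pair_def regular_at_def by auto
  next
    case False
    then have c: "v \<in> cverts S" using v by blast
    have "sgn (tangency Nc b) = sgn (q b)" if "adj F v b" for b
      using q(2) adj_white[OF that v] by (simp add: sgn_idem)
    then show ?thesis
      using regular c ccw_at_cong[of "k v" "k v" v "tangency Nc" q] k(2)[OF c]
      unfolding regular_pair_def regular_at_def by auto
  qed
  ultimately show ?thesis
    unfolding data polar_data_def by (auto simp: k_def q_def)
qed

lemma nets_of_data_of_nets: "nets_of (data_of_nets (Ns, Nc)) = (Ns, Nc)"
proof -
  have ext: "vertex Ns \<in> extensional (sverts S)" "tangency Ns \<in> extensional (black S)"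
      "vertex Nc \<in> extensional (cverts S)" "tangency Nc \<in> extensional (black S)"
    using koebe by (simp_all add: koebe_net_def)
  have "(if b \<in> horizontal S then rp else rm) *\<^sub>R sgn (tangency Ns b) = tangency Ns b"
      "(if b \<in> black S - horizontal S then rp else rm) *\<^sub>R sgn (tangency Ns b) = tangency Nc b"
    if "b \<in> black S" for b
    using norm_tangency[OF that] sgn_tangency[OF that] norm_scaleR_sgn by metis+
  then have "(\<lambda>b\<in>black S. (if b \<in> horizontal S then rp else rm) *\<^sub>R sgn (tangency Ns b)) = tangency Ns"
      "(\<lambda>b\<in>black S. (if b \<in> black S - horizontal S then rp else rm) *\<^sub>R sgn (tangency Ns b)) = tangency Nc"
    by (intro extensionalityI[where A = "black S"]; simp add: ext)+
  moreover have "restrict (\<lambda>v\<in>W. if v \<in> sverts S then vertex Ns v else vertex Nc v) (sverts S) = vertex Ns"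
      "restrict (\<lambda>v\<in>W. if v \<in> sverts S then vertex Ns v else vertex Nc v) (cverts S) = vertex Nc"
    using ext s_c_disjoint by (auto intro!: ext simp: restrict_def extensional_def fun_eq_iff)
  ultimately show ?thesis
    by (simp add: nets_of_def data_of_nets_def cong: restrict_cong)
qed

end

lemma data_of_nets_of:
  assumes kq: "(k, q) \<in> polar_data"
  shows "data_of_nets (nets_of (k, q)) = (k, q)"
proof -
  have "k \<in> extensional W" "q \<in> extensional (black S)"
    using kq by (simp_all add: polar_data_def)
  moreover have "sgn ((if b \<in> horizontal S then rp else rm) *\<^sub>R q b) = q b" if "b \<in> black S" for b
    using kq that radii rp_pos by (intro sgn_unit_scaled) (auto simp: polar_data_def)
  ultimately show ?thesis
    using s_c_disjoint
    by (auto simp: nets_of_def data_of_nets_def restrict_def extensional_def fun_eq_iff)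
qed

lemma bij_betw_data_of_nets:
  "bij_betw data_of_nets {K. dual_koebe_pair S rp rm K \<and> regular_pair S K} polar_data"
  by (rule bij_betw_byWitness[where f' = nets_of])
    (auto simp: data_of_nets_of nets_of_data_of_nets nets_of_polar_data data_of_nets_polar)


section \<open>Ring patterns and polar data\<close>

definition pattern_of :: "('v \<Rightarrow> real^3) \<times> ('v \<Rightarrow> real^3) \<Rightarrow> 'v pattern" where
  "pattern_of = (\<lambda>(k, q).
     \<lparr>ring_at = (\<lambda>v\<in>W. \<lparr>center = sgn (k v),
        inner = (if ccw_at F v (k v) q then 1 else -1) * arccos (rp / norm (k v)),
        outer = arccos (rm / norm (k v))\<rparr>),
      touching = q\<rparr>)"

definition data_of_pattern :: "'v pattern \<Rightarrow> ('v \<Rightarrow> real^3) \<times> ('v \<Rightarrow> real^3)" where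
  "data_of_pattern P =
     (\<lambda>v\<in>W. (rp / cos (inner (ring_at P v))) *\<^sub>R center (ring_at P v), touching P)"

lemma polar_data_ring:
  assumes kq: "(k, q) \<in> polar_data" and v: "v \<in> W"
  defines "A \<equiv> ring_at (pattern_of (k, q)) v"
  shows "center A = sgn (k v)" "norm (center A) = 1"
    "cos (inner A) = rp / norm (k v)" "cos (outer A) = rm / norm (k v)"
    "\<bar>inner A\<bar> = arccos (rp / norm (k v))" "spherical_ring A"
    "inner A > 0 \<longleftrightarrow> ccw_at F v (k v) q"
proof -
  define x y where "x = rp / norm (k v)" and "y = rm / norm (k v)"
  have k: "rp < norm (k v)" using polar_data_norm[OF kq v] .
  have k0: "norm (k v) > 0" using rp_pos k by (rule less_trans)
  have bounds: "0 < x" "x < 1" "0 < y" "y < x"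
    using k k0 radii rp_pos by (simp_all add: x_def y_def divide_strict_right_mono)
  have A: "center A = sgn (k v)" "inner A = (if ccw_at F v (k v) q then 1 else -1) * arccos x"
      "outer A = arccos y"
    using v by (simp_all add: A_def pattern_of_def x_def y_def)
  have pos: "0 < arccos x"
    using arccos_less_arccos[of x 1] bounds by simp
  have less: "arccos x < arccos y"
    using arccos_less_arccos[of y x] bounds by simp
  have le: "arccos y \<le> pi / 2"
    using arccos_le_arccos[of 0 y] bounds by simp
  show c: "center A = sgn (k v)" "norm (center A) = 1"
    using k0 by (auto simp: A(1) norm_sgn)
  have cos: "cos (arccos x) = x" "cos (arccos y) = y"
    using bounds by (auto intro!: cos_arccos)
  show "cos (inner A) = rp / norm (k v)"
    using cos(1) by (simp add: A(2) flip: x_def)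
  show "cos (outer A) = rm / norm (k v)"
    using cos(2) by (simp add: A(3) flip: y_def)
  have inner: "\<bar>inner A\<bar> = arccos x"
    using pos by (simp add: A(2))
  then show "\<bar>inner A\<bar> = arccos (rp / norm (k v))"
    by (simp only: x_def)
  show "spherical_ring A"
    unfolding spherical_ring_def inner A(3) using pos less le c(2) A(2) by auto
  show "inner A > 0 \<longleftrightarrow> ccw_at F v (k v) q"
  proof (cases "ccw_at F v (k v) q")
    case True
    then have "inner A = arccos x" by (simp only: A(2) if_True mult_1_left)
    then show ?thesis using True pos by simp
  next
    case False
    then have "inner A = - arccos x" by (simp only: A(2) if_False mult_minus1)
    then show ?thesis using False pos by simp
  qed
qed

lemma pattern_of_polar_data:
  assumes kq: "(k, q) \<in> polar_data"
  shows "orthogonal_ring_pattern S (pattern_of (k, q)) \<and>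
    global_parameter S (pattern_of (k, q)) (rm / rp)"
proof -
  let ?P = "pattern_of (k, q)"
  let ?A = "ring_at ?P"
  note ring = polar_data_ring[OF kq]
  have q: "norm (q b) = 1" if "b \<in> black S" for b
    using kq that by (auto simp: polar_data_def)
  have touching: "touching ?P = q" by (simp add: pattern_of_def)
  have touches: "q b \<in> circle (center (?A v))
      (if horizontal_edge S v b then \<bar>inner (?A v)\<bar> else outer (?A v))"
    if v: "v \<in> W" and b: "adj F v b" for v b
  proof -
    have "k v \<bullet> q b = radius v b"
      using kq v b by (auto simp: polar_data_def)
    then have "center (?A v) \<bullet> q b = radius v b / norm (k v)"
      using ring(1)[OF v] by (simp add: sgn_div_norm divide_inverse)
    moreover have "outer (?A v) = arccos (rm / norm (k v))"
      using v by (simp add: pattern_of_def)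
    ultimately show ?thesis
      using ring(5)[OF v] q adj_white[OF b v] by (simp add: circle_def radius_def)
  qed
  have orthogonal: "orthogonal_rings (?A v) (?A w)" if v: "v \<in> W" and vw: "opposite F v w" for v w
  proof -
    obtain b d where quad: "(v, b, w, d) \<in> F" using vw by (auto simp: opposite_def)
    have w: "w \<in> W" using quad_types(3)[OF quad v] .
    have adj: "adj F v b" "adj F v d" "adj F w b" "adj F w d"
      using quad quad_adj rotate by blast+
    have "k v \<bullet> k w = 1" using kq v vw by (auto simp: polar_data_def)
    then have c: "center (?A v) \<bullet> center (?A w) = 1 / (norm (k v) * norm (k w))"
      using ring(1)[OF v] ring(1)[OF w] by (simp add: sgn_div_norm divide_inverse)
    have "center (?A v) \<bullet> center (?A w) = cos (outer (?A v)) * cos \<bar>inner (?A w)\<bar>"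
      "center (?A v) \<bullet> center (?A w) = cos \<bar>inner (?A v)\<bar> * cos (outer (?A w))"
      using c ring(3,4)[OF v] ring(3,4)[OF w] radii by (simp_all add: mult.commute)
    moreover have "circle (center (?A v)) (outer (?A v)) \<inter> circle (center (?A w)) \<bar>inner (?A w)\<bar> \<noteq> {}"
      "circle (center (?A v)) \<bar>inner (?A v)\<bar> \<inter> circle (center (?A w)) (outer (?A w)) \<noteq> {}"
      using touches[OF v adj(1)] touches[OF v adj(2)] touches[OF w adj(3)] touches[OF w adj(4)]
        horizontal_edge_quad[OF quad v] by (auto split: if_splits)
    ultimately show ?thesis
      using ring(2,6)[OF v] ring(2,6)[OF w]
      unfolding orthogonal_rings_def by (auto simp: orthogonal_circles_iff spherical_ring_def)
  qed
  have cyclic: "(inner (?A v) > 0 \<longrightarrow> ccw_at F v (center (?A v)) q) \<and>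
      (inner (?A v) < 0 \<longrightarrow> cw_at F v (center (?A v)) q)" if v: "v \<in> W" for v
  proof -
    have "ccw_at F v (k v) q \<or> cw_at F v (k v) q"
      using kq v by (auto simp: polar_data_def)
    moreover have "ccw_at F v (k v) q = ccw_at F v (center (?A v)) q"
      "cw_at F v (k v) q = cw_at F v (center (?A v)) q"
      using ccw_at_cong[of "k v" "center (?A v)" v q q] ring(1)[OF v] by (simp_all add: sgn_idem)
    ultimately show ?thesis using ring(7)[OF v] by auto
  qed
  have "orthogonal_ring_pattern S ?P"
    unfolding orthogonal_ring_pattern_def touching
  proof (intro conjI)
    show "ring_at ?P \<in> extensional W" by (simp add: pattern_of_def)
    show "q \<in> extensional (black S)" using kq by (simp add: polar_data_def)
    show "\<forall>v\<in>W. spherical_ring (?A v)" using ring(6) by blast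
    show "\<forall>v\<in>sverts S. \<forall>w\<in>cverts S. opposite F v w \<longrightarrow> orthogonal_rings (?A v) (?A w)"
      using orthogonal by blast
    show "\<forall>b\<in>black S. \<forall>v\<in>W. adj F v b \<longrightarrow> q b \<in> circle (center (?A v))
        (if horizontal_edge S v b then \<bar>inner (?A v)\<bar> else outer (?A v))"
      using touches by blast
    show "\<forall>v\<in>W. (inner (?A v) > 0 \<longrightarrow> ccw_at F v (center (?A v)) q) \<and>
        (inner (?A v) < 0 \<longrightarrow> cw_at F v (center (?A v)) q)"
      using cyclic by blast
  qed
  moreover have "global_parameter S ?P (rm / rp)"
    unfolding global_parameter_def using ring(3,4) rp_pos by simp
  ultimately show ?thesis by blast
qed

context
  fixes P :: "'v pattern"
  assumes pattern: "orthogonal_ring_pattern S P" and param: "global_parameter S P (rm / rp)"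
begin

lemma pattern_ring:
  assumes v: "v \<in> W"
  shows "norm (center (ring_at P v)) = 1" "inner (ring_at P v) \<noteq> 0"
    "\<bar>inner (ring_at P v)\<bar> < outer (ring_at P v)" "outer (ring_at P v) \<le> pi / 2"
    "rm / rp * cos (inner (ring_at P v)) = cos (outer (ring_at P v))"
    "0 < cos (inner (ring_at P v))"
proof -
  have "spherical_ring (ring_at P v)"
    using pattern v unfolding orthogonal_ring_pattern_def by blast
  then show *: "norm (center (ring_at P v)) = 1" "inner (ring_at P v) \<noteq> 0"
      "\<bar>inner (ring_at P v)\<bar> < outer (ring_at P v)" "outer (ring_at P v) \<le> pi / 2"
    by (auto simp: spherical_ring_def)
  show "rm / rp * cos (inner (ring_at P v)) = cos (outer (ring_at P v))"
    using param v unfolding global_parameter_def by blast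
  show "0 < cos (inner (ring_at P v))"
    using *(3,4) by (intro cos_gt_zero_pi) auto
qed

lemma pattern_touching:
  assumes v: "v \<in> W" and b: "adj F v b"
  shows "norm (touching P b) = 1"
    "center (ring_at P v) \<bullet> touching P b = radius v b / rp * cos (inner (ring_at P v))"
proof -
  note ring = pattern_ring[OF v]
  have "touching P b \<in> circle (center (ring_at P v))
      (if horizontal_edge S v b then \<bar>inner (ring_at P v)\<bar> else outer (ring_at P v))"
    using pattern v b adj_white[OF b v] unfolding orthogonal_ring_pattern_def by blast
  then show "norm (touching P b) = 1"
    "center (ring_at P v) \<bullet> touching P b = radius v b / rp * cos (inner (ring_at P v))"
    using ring rp_pos by (auto simp: circle_iff radius_def split: if_splits)
qed

lemma data_of_pattern_polar: "data_of_pattern P \<in> polar_data"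
proof -
  define k where "k = (\<lambda>v\<in>W. (rp / cos (inner (ring_at P v))) *\<^sub>R center (ring_at P v))"
  define q where "q = touching P"
  let ?c = "\<lambda>v. cos (inner (ring_at P v))"
  have data: "data_of_pattern P = (k, q)" by (simp add: data_of_pattern_def k_def q_def)
  have k: "k v = (rp / ?c v) *\<^sub>R center (ring_at P v)" if "v \<in> W" for v
    using that by (simp add: k_def)
  have "norm (q b) = 1" if b: "b \<in> black S" for b
  proof -
    obtain v w d where "(b, v, w, d) \<in> F" using obtain_quad_at b by blast
    then have "adj F v b" "v \<in> W" using quad_adj adj_black b by blast+
    then show ?thesis using pattern_touching(1) by (simp add: q_def)
  qed
  moreover have "k v \<bullet> q b = radius v b" if "v \<in> W" "adj F v b" for v b
    using pattern_touching(2)[OF that] pattern_ring(6)[OF that(1)] rp_pos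
    by (simp add: k[OF that(1)] q_def)
  moreover have "k v \<bullet> k w = 1" if v: "v \<in> sverts S" and w: "opposite F v w" for v w
  proof -
    have v': "v \<in> W" using v by blast
    have w': "w \<in> W" "w \<in> cverts S" using opposite_white[OF w v'] v by blast+
    have "orthogonal_rings (ring_at P v) (ring_at P w)"
      using pattern v w w'(2) unfolding orthogonal_ring_pattern_def by blast
    then have "center (ring_at P v) \<bullet> center (ring_at P w) = cos (outer (ring_at P v)) * ?c w"
      using pattern_ring[OF v'] pattern_ring[OF w'(1)]
      by (simp add: orthogonal_rings_def orthogonal_circles_iff)
    also have "\<dots> = rm / rp * ?c v * ?c w"
      using pattern_ring(5)[OF v'] by simp
    finally show ?thesis
      using pattern_ring(6)[OF v'] pattern_ring(6)[OF w'(1)] rp_pos radii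
      by (simp add: k[OF v'] k[OF w'(1)])
  qed
  then have "k v \<bullet> k w = 1" if v: "v \<in> W" and w: "opposite F v w" for v w
    using opposite_white[OF w v] opposite_sym[OF w] v w by (metis UnE inner_commute)
  moreover have "ccw_at F v (k v) q \<or> cw_at F v (k v) q" if v: "v \<in> W" for v
  proof -
    have "sgn (k v) = sgn (center (ring_at P v))"
      using pattern_ring(1,6)[OF v] rp_pos by (simp add: k[OF v] sgn_scaleR)
    moreover have "ccw_at F v (center (ring_at P v)) q \<or> cw_at F v (center (ring_at P v)) q"
      using pattern v pattern_ring(2)[OF v]
      unfolding orthogonal_ring_pattern_def q_def by (metis linorder_neqE_linordered_idom)
    ultimately show ?thesis
      using ccw_at_cong[of "k v" "center (ring_at P v)" v q q] by simp
  qed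
  moreover have "q \<in> extensional (black S)"
    using pattern by (simp add: orthogonal_ring_pattern_def q_def)
  moreover have "k \<in> extensional W"
    by (simp add: k_def)
  ultimately show ?thesis
    unfolding data polar_data_def mem_Collect_eq prod.case by blast
qed

lemma pattern_of_data_of_pattern: "pattern_of (data_of_pattern P) = P"
proof -
  let ?k = "\<lambda>v. (rp / cos (inner (ring_at P v))) *\<^sub>R center (ring_at P v)"
  have ring: "center (ring_at P v) = sgn (?k v)"
      "inner (ring_at P v) = (if ccw_at F v (?k v) (touching P) then 1 else -1) * arccos (rp / norm (?k v))"
      "outer (ring_at P v) = arccos (rm / norm (?k v))" if v: "v \<in> W" for v
  proof -
    note r = pattern_ring[OF v]
    show s: "center (ring_at P v) = sgn (?k v)"
      by (rule sgn_unit_scaled[symmetric]) (use r rp_pos in simp_all)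
    have n: "norm (?k v) = rp / cos (inner (ring_at P v))"
      using r rp_pos by simp
    then have "rp / norm (?k v) = cos \<bar>inner (ring_at P v)\<bar>"
      using rp_pos by simp
    then have arccos: "arccos (rp / norm (?k v)) = \<bar>inner (ring_at P v)\<bar>"
      using r(3,4) pi_gt_zero by (simp only: arccos_cos abs_ge_zero)
    have ccw: "ccw_at F v (?k v) (touching P) \<longleftrightarrow> inner (ring_at P v) > 0"
    proof -
      have "ccw_at F v (?k v) (touching P) \<longleftrightarrow> ccw_at F v (center (ring_at P v)) (touching P)"
        by (rule ccw_at_cong) (use s r(1) in \<open>simp_all add: sgn_div_norm\<close>)
      moreover have "inner (ring_at P v) > 0 \<longrightarrow> ccw_at F v (center (ring_at P v)) (touching P)"
          "inner (ring_at P v) < 0 \<longrightarrow> cw_at F v (center (ring_at P v)) (touching P)"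
        using pattern v unfolding orthogonal_ring_pattern_def by blast+
      ultimately show ?thesis
        using not_ccw_at_and_cw_at[of v] v r(2) by (metis UnI2 linorder_neqE_linordered_idom)
    qed
    have "x = (if 0 < x then 1 else -1) * \<bar>x\<bar>" for x :: real
      by simp
    then show "inner (ring_at P v) =
        (if ccw_at F v (?k v) (touching P) then 1 else -1) * arccos (rp / norm (?k v))"
      unfolding arccos ccw .
    have "rm / norm (?k v) = cos (outer (ring_at P v))"
      unfolding n r(5)[symmetric] by simp
    then show "outer (ring_at P v) = arccos (rm / norm (?k v))"
      using r(3,4) arccos_cos[of "outer (ring_at P v)"] pi_gt_zero by simp
  qed
  have "ring_at (pattern_of (data_of_pattern P)) v = ring_at P v" for v
  proof (cases "v \<in> W")
    case True
    have "ring_at (pattern_of (data_of_pattern P)) v = \<lparr>center = sgn (?k v),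
        inner = (if ccw_at F v (?k v) (touching P) then 1 else -1) * arccos (rp / norm (?k v)),
        outer = arccos (rm / norm (?k v))\<rparr>"
      using True by (simp only: pattern_of_def data_of_pattern_def
          prod.case pattern.select_convs restrict_apply if_True)
    also have "\<dots> = ring_at P v"
      unfolding ring[OF True, symmetric] by (rule ring.equality) simp_all
    finally show ?thesis .
  next
    case False
    moreover have "ring_at P \<in> extensional W"
      using pattern by (simp add: orthogonal_ring_pattern_def)
    ultimately show ?thesis
      by (simp add: pattern_of_def data_of_pattern_def extensional_def)
  qed
  then have "ring_at (pattern_of (data_of_pattern P)) = ring_at P" by blast
  then show ?thesis
    by (intro pattern.equality) (simp_all add: pattern_of_def data_of_pattern_def)
qed

end

lemma data_of_pattern_of:
  assumes kq: "(k, q) \<in> polar_data"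
  shows "data_of_pattern (pattern_of (k, q)) = (k, q)"
proof -
  have "(rp / cos (inner (ring_at (pattern_of (k, q)) v))) *\<^sub>R center (ring_at (pattern_of (k, q)) v) = k v"
    if "v \<in> W" for v
    using polar_data_ring[OF kq that] rp_pos by (simp add: norm_scaleR_sgn)
  moreover have "k \<in> extensional W"
    using kq by (simp add: polar_data_def)
  ultimately have "(\<lambda>v\<in>W. (rp / cos (inner (ring_at (pattern_of (k, q)) v))) *\<^sub>R
      center (ring_at (pattern_of (k, q)) v)) = k"
    by (intro extensionalityI[where A = W]) simp_all
  then show ?thesis
    by (simp add: data_of_pattern_def) (simp add: pattern_of_def)
qed

lemma bij_betw_pattern_of:
  "bij_betw pattern_of polar_data {P. orthogonal_ring_pattern S P \<and> global_parameter S P (rm / rp)}"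
  by (rule bij_betw_byWitness[where f' = data_of_pattern])
    (auto simp: data_of_pattern_of pattern_of_data_of_pattern pattern_of_polar_data data_of_pattern_polar)

lemma corresponds_pattern_of_data_of_nets:
  assumes "dual_koebe_pair S rp rm (Ns, Nc)" "regular_pair S (Ns, Nc)"
  shows "corresponds S (Ns, Nc) (pattern_of (data_of_nets (Ns, Nc)))"
  using sgn_tangency[OF assms] s_c_disjoint
  by (auto simp: corresponds_def pattern_of_def data_of_nets_def)

end

theorem theorem4p6:
  fixes S :: "'v sgraph" and rp rm :: real
  assumes "s_quad_graph S"
    and "alternating_colouring S"
    and "rp > rm" and "rm > 0" and "rp * rm = 1"
  shows "\<exists>\<Phi>. bij_betw \<Phi>
            {K. dual_koebe_pair S rp rm K \<and> regular_pair S K}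
            {P. orthogonal_ring_pattern S P \<and> global_parameter S P (rm / rp)} \<and>
          (\<forall>K. dual_koebe_pair S rp rm K \<longrightarrow> regular_pair S K \<longrightarrow> corresponds S K (\<Phi> K))"
proof -
  interpret coloured_s_quad_graph S rp rm
    using assms by unfold_locales
  show ?thesis
  proof (intro exI conjI allI impI)
    show "bij_betw (pattern_of \<circ> data_of_nets)
        {K. dual_koebe_pair S rp rm K \<and> regular_pair S K}
        {P. orthogonal_ring_pattern S P \<and> global_parameter S P (rm / rp)}"
      using bij_betw_data_of_nets bij_betw_pattern_of by (rule bij_betw_trans)
    show "corresponds S K ((pattern_of \<circ> data_of_nets) K)"
      if "dual_koebe_pair S rp rm K" "regular_pair S K" for K
      using that corresponds_pattern_of_data_of_nets by (cases K) simp
  qed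
qed

end
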